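(* Every distributive algebraic lattice with at most $\aleph_1$ compact elements is isomorphic to the normal subgroup lattice of some locally finite group.
   Context: A group is locally finite if each of its finitely generated subgroups is finite. The normal subgroup lattice of a group is the lattice of all its normal subgroups ordered by inclusion. *)

theory Defs
  imports "HOL-Algebra.Coset" "HOL-Algebra.Generated_Groups"
begin

unbundle cardinal_syntax

definition compact_elements :: "('a, 'b) gorder_scheme \<Rightarrow> 'a set" where
  "compact_elements L = {k \<in> carrier L. \<forall>A \<subseteq> carrier L.
     k \<sqsubseteq>\<^bsub>L\<^esub> \<Squnion>\<^bsub>L\<^esub> A \<longrightarrow> (\<exists>B. finite B \<and> B \<subseteq> A \<and> k \<sqsubseteq>\<^bsub>L\<^esub> \<Squnion>\<^bsub>L\<^esub> B)}"

locale algebraic_lattice = complete_lattice L for L (structure) +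
  assumes sup_of_compacts:
    "x \<in> carrier L \<Longrightarrow> \<exists>K \<subseteq> compact_elements L. x = \<Squnion>K"

locale distributive_lattice = lattice L for L (structure) +
  assumes meet_join_distrib:
    "\<lbrakk>x \<in> carrier L; y \<in> carrier L; z \<in> carrier L\<rbrakk>
      \<Longrightarrow> x \<sqinter> (y \<squnion> z) = (x \<sqinter> y) \<squnion> (x \<sqinter> z)"

text \<open>
  An order isomorphism between lattices automatically preserves all existing joins and meets.
\<close>

definition lattice_isomorphic ::
    "('a, 'm) gorder_scheme \<Rightarrow> ('b, 'n) gorder_scheme \<Rightarrow> bool" where
  "lattice_isomorphic L M \<longleftrightarrow> (\<exists>f. bij_betw f (carrier L) (carrier M) \<and>
     (\<forall>x \<in> carrier L. \<forall>y \<in> carrier L. x \<sqsubseteq>\<^bsub>L\<^esub> y \<longleftrightarrow> f x \<sqsubseteq>\<^bsub>M\<^esub> f y))"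

definition normal_subgroup_lattice :: "('g, 'm) monoid_scheme \<Rightarrow> 'g set gorder" where
  "normal_subgroup_lattice G = \<lparr>carrier = {N. N \<lhd> G}, eq = (=), le = (\<subseteq>)\<rparr>"

locale locally_finite_group = group G for G (structure) +
  assumes finite_generate:
    "\<lbrakk>A \<subseteq> carrier G; finite A\<rbrakk> \<Longrightarrow> finite (generate G A)"

text \<open>
  HOL cannot quantify existentially over types, so the asserted group must live in a fixed type.
  We take \<open>nat set\<close>, which has the cardinality of the continuum and hence at least \<open>\<aleph>\<^sub>1\<close> elements.
  This loses no generality: if a (locally finite) group \<open>H\<close> of any size has a normal subgroup
  lattice with at most \<open>\<aleph>\<^sub>1\<close> compact elements (the finitely generated normal subgroups), then a
  Loewenheim-Skolem argument gives a subgroup of \<open>H\<close> with at most \<open>\<aleph>\<^sub>1\<close> elements and an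
  isomorphic normal subgroup lattice: choose normal generators of every finitely generated normal
  subgroup, and close under conjugators witnessing membership of an element in the normal closure
  of a finite set. Local finiteness passes to subgroups.
\<close>

type_synonym group_universe = "nat set"

abbreviation aleph_one :: "nat set rel" where
  "aleph_one \<equiv> cardSuc natLeq"

end

theory Submission
  imports Defs "HOL-Algebra.Product_Groups" "HOL-Algebra.Weak_Morphisms"
    "HOL-Combinatorics.Permutations" "HOL-Library.Countable_Set"
begin

text \<open>
  Call a group \<open>G\<close> valued if every \<open>x \<in> carrier G\<close> carries a compact element \<open>\<mu> x\<close> of \<open>L\<close>, in such a
  way that each set \<open>{x. \<mu> x \<sqsubseteq> d}\<close> is a normal subgroup and only the identity has the least value.
  Suppose that every compact element is a value and that \<open>\<mu> x \<sqsubseteq> \<Squnion>(\<mu> ` Y)\<close>, for a finite set \<open>Y\<close>,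
  forces \<open>x\<close> into the normal closure of \<open>Y\<close>; in this case \<open>G\<close> is said to separate itself. Then
  \<open>d \<mapsto> {x. \<mu> x \<sqsubseteq> d}\<close> is an isomorphism from \<open>L\<close> onto the lattice of normal subgroups: it reflects the
  order because all compact elements are values, and a normal subgroup \<open>N\<close> is the image of \<open>\<Squnion>(\<mu> ` N)\<close>
  because values are compact (\<open>lattice_isomorphic_normal_subgroups\<close>). What remains is to construct such
  a group that is locally finite.

  The main step is an amalgamation of finite groups (\<open>valued_amalgam\<close>): two finite valued groups with a
  common valued subgroup embed into a third one, in which all missing normal closure relations of the
  first one hold. Only finitely many values occur. By distributivity there are finitely many
  thresholds \<open>d\<close> with compact weights \<open>c d\<close> such that each occurring value \<open>v\<close> is the join of the
  weights of those \<open>d\<close> with \<open>\<not> v \<sqsubseteq> d\<close> (\<open>finite_compact_decomposition\<close>). For one threshold \<open>d\<close>, divide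
  out the elements of value \<open>\<sqsubseteq> d\<close>; the two quotients still share the image of the common subgroup,
  and they are amalgamated in a finite symmetric group by B. H. Neumann's permutational product. In the
  product of these symmetric groups let the value of an element be the join of the weights of its
  nontrivial coordinates. This value extends the given ones. If \<open>\<mu> x \<sqsubseteq> \<Squnion>(\<mu> ` Y)\<close>, then at each
  coordinate where \<open>x\<close> is nontrivial some \<open>y \<in> Y\<close> is nontrivial as well. All permutations act on two
  copies of the underlying set, so that the commutators with a single nontrivial one already normally
  generate all of them (\<open>double_in_normal_subgroup\<close>); hence \<open>x\<close> is in the normal closure of \<open>Y\<close>.

  A countable locally finite group is the union of a sequence of finite subgroups. Amalgamating them one
  after the other yields a countable valued extension that separates itself and in which a prescribed
  compact element is a value (\<open>countable_extension\<close>). Finally, well-order the compact elements so that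
  every proper initial segment is countable; this is possible exactly because there are at most \<open>\<aleph>\<^sub>1\<close> of
  them. At stage \<open>a\<close> the union of the groups built before is countable, and it is extended to a group
  that separates itself and has the value \<open>a\<close>. The union of all stages is the required group
  (\<open>realizing_valued_group\<close>).
\<close>

section \<open>Finite sets of compact elements in a distributive algebraic lattice\<close>

locale distributive_algebraic_lattice = algebraic_lattice L + distributive_lattice L for L (structure)
begin

lemma compact_carrier: "k \<in> compact_elements L \<Longrightarrow> k \<in> carrier L"
  by (simp add: compact_elements_def)

lemma compactD:
  assumes "k \<in> compact_elements L" "A \<subseteq> carrier L" "k \<sqsubseteq> \<Squnion>A"
  shows "\<exists>B. finite B \<and> B \<subseteq> A \<and> k \<sqsubseteq> \<Squnion>B"
  using assms by (simp add: compact_elements_def)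

lemma sup_le_iff:
  assumes A: "A \<subseteq> carrier L" and z: "z \<in> carrier L"
  shows "\<Squnion>A \<sqsubseteq> z \<longleftrightarrow> (\<forall>a\<in>A. a \<sqsubseteq> z)"
proof
  assume *: "\<Squnion>A \<sqsubseteq> z"
  show "\<forall>a\<in>A. a \<sqsubseteq> z"
  proof
    fix a assume "a \<in> A"
    then show "a \<sqsubseteq> z" using A z by (intro le_trans[OF sup_upper[OF A] *]) auto
  qed
qed (use sup_least[OF A z] in blast)

lemma sup_mono:
  assumes "A \<subseteq> B" "B \<subseteq> carrier L"
  shows "\<Squnion>A \<sqsubseteq> \<Squnion>B"
  using assms by (intro sup_least sup_closed) (auto intro: sup_upper)

lemma sup_empty_le: "x \<in> carrier L \<Longrightarrow> \<Squnion>{} \<sqsubseteq> x"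
  by (rule sup_least) auto

lemma le_bottom_iff: "x \<in> carrier L \<Longrightarrow> x \<sqsubseteq> \<Squnion>{} \<longleftrightarrow> x = \<Squnion>{}"
  using le_antisym[OF _ sup_empty_le[of x] _ sup_closed] le_refl[of x] by fastforce

text \<open>Each member of a finite set of compact elements needs only finitely many of the covering elements.\<close>

lemma compact_Sup:
  assumes "finite B" "B \<subseteq> compact_elements L"
  shows "\<Squnion>B \<in> compact_elements L"
proof -
  have B: "B \<subseteq> carrier L" using assms compact_carrier by blast
  have "\<exists>F. finite F \<and> F \<subseteq> A \<and> \<Squnion>B \<sqsubseteq> \<Squnion>F" if A: "A \<subseteq> carrier L" "\<Squnion>B \<sqsubseteq> \<Squnion>A" for A
  proof -
    have "\<forall>b\<in>B. \<exists>F. finite F \<and> F \<subseteq> A \<and> b \<sqsubseteq> \<Squnion>F"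
    proof
      fix b assume b: "b \<in> B"
      have "b \<sqsubseteq> \<Squnion>A"
        by (rule le_trans[OF sup_upper[OF B b] A(2) subsetD[OF B b] sup_closed[OF B] sup_closed[OF A(1)]])
      then show "\<exists>F. finite F \<and> F \<subseteq> A \<and> b \<sqsubseteq> \<Squnion>F"
        using compactD[OF _ A(1)] assms(2) b by blast
    qed
    then obtain F where F: "\<And>b. b \<in> B \<Longrightarrow> finite (F b) \<and> F b \<subseteq> A \<and> b \<sqsubseteq> \<Squnion>(F b)"
      by metis
    have UA: "(\<Union>b\<in>B. F b) \<subseteq> A" using F by blast
    have "b \<sqsubseteq> \<Squnion>(\<Union>b\<in>B. F b)" if "b \<in> B" for b
    proof (rule le_trans)
      show "b \<sqsubseteq> \<Squnion>(F b)" using F that by blast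
      show "\<Squnion>(F b) \<sqsubseteq> \<Squnion>(\<Union>b\<in>B. F b)" using UA A that by (intro sup_mono) auto
      show "b \<in> carrier L" "\<Squnion>(F b) \<in> carrier L" "\<Squnion>(\<Union>b\<in>B. F b) \<in> carrier L"
        using that B UA A(1) by (auto intro!: sup_closed)
    qed
    then have "\<Squnion>B \<sqsubseteq> \<Squnion>(\<Union>b\<in>B. F b)"
      by (intro sup_least[OF B] sup_closed order_trans[OF UA A(1)])
    then show ?thesis
      using F UA assms(1) by (intro exI[of _ "\<Union>b\<in>B. F b"] conjI finite_UN_I) simp_all
  qed
  then show ?thesis using B by (simp add: compact_elements_def)
qed

text \<open>This is the dual distributive law, in the form in which it pulls finite meets out of a join.\<close>

lemma le_join_meet:
  assumes [simp]: "v \<in> carrier L" "a \<in> carrier L" "u \<in> carrier L" "w \<in> carrier L"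
    and vu: "v \<sqsubseteq> a \<squnion> u" and vw: "v \<sqsubseteq> a \<squnion> w"
  shows "v \<sqsubseteq> a \<squnion> (u \<sqinter> w)"
proof -
  let ?t = "a \<squnion> (u \<sqinter> w)"
  have t [simp]: "?t \<in> carrier L" by simp
  have at: "a \<sqsubseteq> ?t" and uwt: "u \<sqinter> w \<sqsubseteq> ?t" by (simp_all add: join_left join_right)
  have "v \<sqinter> u \<sqsubseteq> v" by (simp add: meet_left)
  then have "v \<sqinter> u \<sqsubseteq> a \<squnion> w" by (rule le_trans[OF _ vw]) simp_all
  then have "v \<sqinter> u = (v \<sqinter> u) \<sqinter> (a \<squnion> w)"
    using le_iff_join[of "v \<sqinter> u" "a \<squnion> w"] by simp
  also have "\<dots> = ((v \<sqinter> u) \<sqinter> a) \<squnion> ((v \<sqinter> u) \<sqinter> w)"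
    by (rule meet_join_distrib) simp_all
  also have "\<dots> \<sqsubseteq> ?t"
  proof (rule join_le)
    have "(v \<sqinter> u) \<sqinter> a \<sqsubseteq> a" by (simp add: meet_right)
    then show "(v \<sqinter> u) \<sqinter> a \<sqsubseteq> ?t" by (rule le_trans[OF _ at]) simp_all
    have "(v \<sqinter> u) \<sqinter> w \<sqsubseteq> v \<sqinter> u" "v \<sqinter> u \<sqsubseteq> u" "(v \<sqinter> u) \<sqinter> w \<sqsubseteq> w"
      by (simp_all add: meet_left meet_right)
    then have "(v \<sqinter> u) \<sqinter> w \<sqsubseteq> u \<sqinter> w"
      by (intro meet_le) (auto intro: le_trans[of _ "v \<sqinter> u"])
    then show "(v \<sqinter> u) \<sqinter> w \<sqsubseteq> ?t" by (rule le_trans[OF _ uwt]) simp_all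
  qed simp_all
  finally have vut: "v \<sqinter> u \<sqsubseteq> ?t" .
  have "v = v \<sqinter> (a \<squnion> u)"
    using vu le_iff_join[of v "a \<squnion> u"] by simp
  also have "\<dots> = (v \<sqinter> a) \<squnion> (v \<sqinter> u)"
    by (rule meet_join_distrib) simp_all
  also have "\<dots> \<sqsubseteq> ?t"
  proof (rule join_le[OF _ vut])
    have "v \<sqinter> a \<sqsubseteq> a" by (simp add: meet_right)
    then show "v \<sqinter> a \<sqsubseteq> ?t" by (rule le_trans[OF _ at]) simp_all
  qed simp_all
  finally show ?thesis .
qed

lemma le_join_Inf:
  assumes "finite U" "U \<noteq> {}" "U \<subseteq> carrier L" "v \<in> carrier L" "a \<in> carrier L"
    and "\<And>u. u \<in> U \<Longrightarrow> v \<sqsubseteq> a \<squnion> u"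
  shows "v \<sqsubseteq> a \<squnion> \<Sqinter>U"
  using assms
proof (induction U rule: finite_ne_induct)
  case (singleton x)
  then show ?case by simp
next
  case (insert x F)
  then have "v \<sqsubseteq> a \<squnion> (x \<sqinter> \<Sqinter>F)"
    by (intro le_join_meet) auto
  moreover have "x \<sqinter> \<Sqinter>F = \<Sqinter>(insert x F)"
    using weak_inf_insert insert by (metis eq_is_equal insert_subset)
  ultimately show ?case by simp
qed


text \<open>
  For \<open>d = \<Squnion>T\<close> with \<open>T \<subseteq> V\<close>, the element \<open>e d\<close> is the largest one below all members of \<open>V\<close> that are
  not below \<open>d\<close>. Writing \<open>s\<close> for the right-hand side, the claim is the case \<open>T = {}\<close> of
  \<open>v \<sqsubseteq> s \<squnion> \<Squnion>T\<close>. This is proved by downward induction on \<open>T\<close>: if \<open>\<not> v \<sqsubseteq> d\<close>, the induction hypothesis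
  for the sets \<open>insert u T\<close> with \<open>\<not> u \<sqsubseteq> d\<close>, together with distributivity, gives \<open>v \<sqsubseteq> s \<squnion> d \<squnion> e d\<close>, and
  \<open>e d \<sqsubseteq> s\<close>.
\<close>

lemma le_Sup_of_separating_meets:
  fixes V
  defines "e \<equiv> \<lambda>d. \<Sqinter>{u \<in> V. \<not> u \<sqsubseteq> d}"
  assumes V: "finite V" "V \<subseteq> carrier L" and v: "v \<in> V"
  shows "v \<sqsubseteq> \<Squnion>(e ` {d \<in> (\<lambda>T. \<Squnion>T) ` Pow V. \<not> v \<sqsubseteq> d})"
proof -
  let ?E = "e ` {d \<in> (\<lambda>T. \<Squnion>T) ` Pow V. \<not> v \<sqsubseteq> d}"
  define s where "s = \<Squnion>?E"
  have vL: "v \<in> carrier L" using V v by blast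
  have ecl: "e d \<in> carrier L" for d using V unfolding e_def by (intro inf_closed) auto
  have EL: "?E \<subseteq> carrier L" using ecl by blast
  have sL: "s \<in> carrier L" unfolding s_def using EL by (rule sup_closed)
  have "v \<sqsubseteq> s \<squnion> \<Squnion>T" if "T \<subseteq> V" for T
    using that
  proof (induction "card (V - T)" arbitrary: T rule: less_induct)
    case less
    have TL: "T \<subseteq> carrier L" using less.prems V by blast
    define d where "d = \<Squnion>T"
    have dL: "d \<in> carrier L" unfolding d_def using TL by (rule sup_closed)
    show ?case
    proof (cases "v \<sqsubseteq> d")
      case True
      then show ?thesis
        unfolding d_def[symmetric]
        by (rule le_trans[OF _ join_right[OF sL dL]]) (use vL dL sL in auto)
    next
      case False
      let ?U = "{u \<in> V. \<not> u \<sqsubseteq> d}"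
      have UL: "?U \<subseteq> carrier L" using V by blast
      have "v \<sqsubseteq> (s \<squnion> d) \<squnion> u" if u: "u \<in> ?U" for u
      proof -
        have uL: "u \<in> carrier L" using u V by blast
        have "u \<notin> T" using u sup_upper[of T u] TL unfolding d_def by blast
        then have "card (V - insert u T) < card (V - T)"
          using u V by (intro psubset_card_mono) auto
        then have *: "v \<sqsubseteq> s \<squnion> \<Squnion>(insert u T)"
          using less u by blast
        have "\<Squnion>(insert u T) = u \<squnion> d"
          unfolding d_def using weak_sup_insert[of u T] uL TL by (simp add: eq_is_equal)
        with * show ?thesis unfolding join_assoc[OF sL dL uL] join_comm[of L d u] by argo
      qed
      then have "v \<sqsubseteq> (s \<squnion> d) \<squnion> e d"
        unfolding e_def using V v False vL sL dL UL by (intro le_join_Inf) auto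
      moreover have "e d \<sqsubseteq> s"
        unfolding s_def using False less.prems EL by (intro sup_upper) (auto simp: d_def)
      then have "e d \<sqsubseteq> s \<squnion> d"
        by (rule le_trans[OF _ join_left[OF sL dL]]) (use ecl[of d] dL sL in auto)
      then have "(s \<squnion> d) \<squnion> e d \<sqsubseteq> s \<squnion> d"
        by (intro join_le le_refl join_closed sL dL ecl)
      ultimately have "v \<sqsubseteq> s \<squnion> d"
        by (rule le_trans) (intro vL join_closed sL dL ecl)+
      then show ?thesis unfolding d_def .
    qed
  qed
  then have "v \<sqsubseteq> s \<squnion> \<Squnion>{}" by blast
  moreover have "s \<squnion> \<Squnion>{} \<sqsubseteq> s"
    by (intro join_le le_refl sL sup_empty_le sup_closed) auto
  ultimately have "v \<sqsubseteq> s"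
    by (rule le_trans) (auto intro!: vL join_closed sL sup_closed)
  then show ?thesis unfolding s_def .
qed

text \<open>
  The meets of the previous lemma need not be compact, but each is a join of compact elements, and
  finitely many of these suffice for the finitely many compact \<open>v \<in> V\<close>. Thresholds whose weight would be
  the least element are dropped, because a coordinate of weight \<open>\<Squnion>{}\<close> would allow nontrivial elements of
  value \<open>\<Squnion>{}\<close>.
\<close>

lemma finite_compact_decomposition:
  assumes V: "finite V" "V \<subseteq> compact_elements L"
  obtains I c where "finite I" "I \<subseteq> carrier L"
    "\<And>d. d \<in> I \<Longrightarrow> c d \<in> compact_elements L \<and> c d \<noteq> \<Squnion>{}"
    "\<And>v d. \<lbrakk>v \<in> V; d \<in> I; \<not> v \<sqsubseteq> d\<rbrakk> \<Longrightarrow> c d \<sqsubseteq> v"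
    "\<And>v. v \<in> V \<Longrightarrow> v \<sqsubseteq> \<Squnion>(c ` {d \<in> I. \<not> v \<sqsubseteq> d})"
proof -
  have VL: "V \<subseteq> carrier L" using V compact_carrier by blast
  define e where "e d = \<Sqinter>{u \<in> V. \<not> u \<sqsubseteq> d}" for d
  \<comment> \<open>The candidates for thresholds, before those of weight \<open>\<Squnion>{}\<close> are dropped.\<close>
  define J where "J = (\<lambda>T. \<Squnion>T) ` Pow V"
  have J: "finite J" "J \<subseteq> carrier L"
    unfolding J_def using V VL by (auto intro!: sup_closed)
  have ecl: "e d \<in> carrier L" for d using VL unfolding e_def by (intro inf_closed) auto
  obtain K where K: "\<And>d. K d \<subseteq> compact_elements L \<and> e d = \<Squnion>(K d)"
    using sup_of_compacts[OF ecl] by metis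
  have KL: "K d \<subseteq> carrier L" for d using K compact_carrier by blast
  have "\<exists>B. finite B \<and> B \<subseteq> (\<Union>d\<in>{d\<in>J. \<not> v \<sqsubseteq> d}. K d) \<and> v \<sqsubseteq> \<Squnion>B" if v: "v \<in> V" for v
  proof (rule compactD)
    let ?U = "\<Union>d\<in>{d\<in>J. \<not> v \<sqsubseteq> d}. K d"
    show "v \<in> compact_elements L" using v V by blast
    show UL: "?U \<subseteq> carrier L" using KL by blast
    have vL: "v \<in> carrier L" using v VL by blast
    have "v \<sqsubseteq> \<Squnion>(e ` {d\<in>J. \<not> v \<sqsubseteq> d})"
      unfolding J_def e_def using le_Sup_of_separating_meets[OF V(1) VL v] by blast
    moreover have "\<Squnion>(e ` {d\<in>J. \<not> v \<sqsubseteq> d}) \<sqsubseteq> \<Squnion>?U"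
    proof (rule sup_least)
      fix y assume "y \<in> e ` {d\<in>J. \<not> v \<sqsubseteq> d}"
      then obtain d where d: "d \<in> J" "\<not> v \<sqsubseteq> d" "y = \<Squnion>(K d)" using K by auto
      then show "y \<sqsubseteq> \<Squnion>?U" using UL by (auto intro!: sup_mono)
    qed (use ecl UL in \<open>auto intro: sup_closed\<close>)
    ultimately show "v \<sqsubseteq> \<Squnion>?U"
      by (rule le_trans) (use vL UL ecl in \<open>auto intro!: sup_closed\<close>)
  qed
  then obtain B where B: "\<And>v. v \<in> V \<Longrightarrow> finite (B v)"
    "\<And>v. v \<in> V \<Longrightarrow> B v \<subseteq> (\<Union>d\<in>{d\<in>J. \<not> v \<sqsubseteq> d}. K d)" "\<And>v. v \<in> V \<Longrightarrow> v \<sqsubseteq> \<Squnion>(B v)"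
    by metis
  define F where "F d = (\<Union>v\<in>V. B v) \<inter> K d" for d
  define c where "c d = \<Squnion>(F d)" for d
  define I where "I = {d \<in> J. c d \<noteq> \<Squnion>{}}"
  have F: "finite (F d)" "F d \<subseteq> compact_elements L" for d
    unfolding F_def using V(1) B(1) apply simp using K by blast
  have FL: "F d \<subseteq> carrier L" for d using F compact_carrier by blast
  have cL: "c d \<in> carrier L" for d unfolding c_def using FL by (rule sup_closed)
  show thesis
  proof
    show "finite I" "I \<subseteq> carrier L" using J unfolding I_def by auto
    show "c d \<in> compact_elements L \<and> c d \<noteq> \<Squnion>{}" if "d \<in> I" for d
      using that F compact_Sup unfolding I_def c_def by auto
    show "c d \<sqsubseteq> v" if "v \<in> V" "d \<in> I" "\<not> v \<sqsubseteq> d" for v d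
    proof -
      have "c d \<sqsubseteq> e d" using K KL[of d] sup_mono[of "F d" "K d"] unfolding c_def F_def by auto
      moreover have "e d \<sqsubseteq> v" unfolding e_def using that VL by (intro inf_lower) auto
      ultimately show ?thesis by (rule le_trans) (use cL ecl VL that in auto)
    qed
    show "v \<sqsubseteq> \<Squnion>(c ` {d \<in> I. \<not> v \<sqsubseteq> d})" if v: "v \<in> V" for v
    proof -
      let ?S = "\<Squnion>(c ` {d \<in> I. \<not> v \<sqsubseteq> d})"
      have SL: "?S \<in> carrier L" using cL by (intro sup_closed) auto
      have BL: "B v \<subseteq> carrier L" using B(2)[OF v] KL by blast
      have "b \<sqsubseteq> ?S" if b: "b \<in> B v" for b
      proof -
        obtain d where d: "d \<in> J" "\<not> v \<sqsubseteq> d" "b \<in> K d" using B(2)[OF v] b by blast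
        have bc: "b \<sqsubseteq> c d" unfolding c_def
          using d b v FL by (intro sup_upper) (auto simp: F_def)
        show ?thesis
        proof (cases "d \<in> I")
          case True
          then have "c d \<sqsubseteq> ?S" using d cL by (intro sup_upper) auto
          then show ?thesis by (rule le_trans[OF bc]) (use SL cL BL b in auto)
        next
          case False
          then have "b \<sqsubseteq> \<Squnion>{}" using bc d by (simp add: I_def)
          then show ?thesis
            by (rule le_trans[OF _ sup_empty_le[OF SL]]) (use SL BL b in auto)
        qed
      qed
      then have "\<Squnion>(B v) \<sqsubseteq> ?S" using BL SL by (intro sup_least) auto
      then show ?thesis by (rule le_trans[OF B(3)[OF v]]) (use SL BL VL v in auto)
    qed
  qed
qed

end

section \<open>Doubled permutations\<close>

definition perm_group :: "'a set \<Rightarrow> ('a \<Rightarrow> 'a) monoid"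
  where "perm_group X = \<lparr>carrier = {p. p permutes X}, monoid.mult = (\<circ>), one = id\<rparr>"

lemma perm_group_simps [simp]:
  "p \<in> carrier (perm_group X) \<longleftrightarrow> p permutes X"
  "p \<otimes>\<^bsub>perm_group X\<^esub> q = p \<circ> q"
  "\<one>\<^bsub>perm_group X\<^esub> = id"
  by (simp_all add: perm_group_def)

lemma group_perm_group [simp]: "group (perm_group X)"
proof (rule groupI)
  fix p assume "p \<in> carrier (perm_group X)"
  then show "\<exists>q\<in>carrier (perm_group X). q \<otimes>\<^bsub>perm_group X\<^esub> p = \<one>\<^bsub>perm_group X\<^esub>"
    by (intro bexI[of _ "inv_into UNIV p"]) (simp_all add: permutes_inv permutes_inv_o)
qed (simp_all add: permutes_compose permutes_id comp_assoc)

lemma inv_perm_group [simp]: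
  assumes "p permutes X"
  shows "inv\<^bsub>perm_group X\<^esub> p = inv_into UNIV p"
  by (rule group.inv_equality) (use assms in \<open>simp_all add: permutes_inv permutes_inv_o\<close>)

lemma finite_perm_group: "finite X \<Longrightarrow> finite (carrier (perm_group X))"
  by (simp add: perm_group_def finite_permutations)

lemma permutes_extend:
  assumes "finite Z" "A \<subseteq> Z" "inj_on f A" "f ` A \<subseteq> Z"
  obtains \<sigma> where "\<sigma> permutes Z" "\<And>x. x \<in> A \<Longrightarrow> \<sigma> x = f x"
proof -
  have "card (Z - A) = card (Z - f ` A)"
    using assms by (simp add: card_Diff_subset card_image finite_subset)
  then obtain g where g: "bij_betw g (Z - A) (Z - f ` A)"
    using assms by (metis bij_betw_iff_card finite_Diff)
  define \<sigma> where "\<sigma> x = (if x \<in> A then f x else if x \<in> Z then g x else x)" for x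
  have "bij_betw \<sigma> (A \<union> (Z - A)) (f ` A \<union> (Z - f ` A))"
  proof (rule bij_betw_combine)
    show "bij_betw \<sigma> A (f ` A)"
      using assms by (simp add: \<sigma>_def inj_on_imp_bij_betw cong: bij_betw_cong)
    show "bij_betw \<sigma> (Z - A) (Z - f ` A)"
      using g by (rule bij_betw_cong[THEN iffD1, rotated]) (auto simp: \<sigma>_def)
  qed auto
  then have "bij_betw \<sigma> Z Z"
    using assms by (simp add: Un_absorb1)
  then have "\<sigma> permutes Z"
    using assms(2) by (intro bij_imp_permutes) (auto simp: \<sigma>_def)
  then show thesis using that by (simp add: \<sigma>_def)
qed

lemma conjugate_transpose:
  assumes "bij \<sigma>"
  shows "\<sigma> \<circ> transpose p q \<circ> inv_into UNIV \<sigma> = transpose (\<sigma> p) (\<sigma> q)"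
proof
  fix x
  obtain y where y: "x = \<sigma> y" using assms by (meson bij_pointE)
  then show "(\<sigma> \<circ> transpose p q \<circ> inv_into UNIV \<sigma>) x = transpose (\<sigma> p) (\<sigma> q) x"
    using assms by (auto simp: transpose_def bij_is_inj bij_betw_def inj_eq)
qed

text \<open>
  Doubling makes every permutation even, and it turns transpositions into products of two disjoint
  transpositions.
\<close>

definition double :: "('a \<Rightarrow> 'a) \<Rightarrow> 'a \<times> bool \<Rightarrow> 'a \<times> bool"
  where "double p = map_prod p id"

lemma double_comp: "double (p \<circ> q) = double p \<circ> double q"
  by (auto simp: double_def)

lemma double_id [simp]: "double id = id"
  by (auto simp: double_def prod.map_id0)

lemma double_permutes:
  assumes "p permutes X"
  shows "double p permutes (X \<times> UNIV)"
proof (rule bij_imp_permutes)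
  have "bij_betw p X X" using assms by (rule permutes_imp_bij)
  then show "bij_betw (double p) (X \<times> UNIV) (X \<times> UNIV)"
    unfolding double_def by (rule bij_betw_map_prod) simp
  show "\<And>x. x \<notin> X \<times> UNIV \<Longrightarrow> double p x = x"
    using assms by (fastforce simp: double_def dest: permutes_not_in)
qed

lemma double_transpose:
  assumes "u \<noteq> v"
  shows "double (transpose u v) = transpose (u, False) (v, False) \<circ> transpose (u, True) (v, True)"
  by (auto simp: double_def transpose_def fun_eq_iff)

text \<open>
  If \<open>a\<close> moves \<open>x\<close>, the commutator of \<open>double a\<close> with the transposition of the two copies of \<open>x\<close> is a
  product of two disjoint transpositions. So is \<open>double (transpose u v)\<close>, and therefore the two are
  conjugate; moreover these elements generate all \<open>double b\<close>.
\<close>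

lemma double_in_normal_subgroup:
  assumes X: "finite X" and M: "M \<lhd> perm_group (X \<times> UNIV)"
    and a: "a permutes X" "a \<noteq> id" and b: "b permutes X"
    and comm: "\<And>s. s permutes (X \<times> UNIV) \<Longrightarrow>
      double a \<circ> s \<circ> inv_into UNIV (double a) \<circ> inv_into UNIV s \<in> M"
  shows "double b \<in> M"
proof -
  let ?Z = "X \<times> (UNIV :: bool set)"
  interpret M: normal M "perm_group ?Z" by (rule M)
  obtain x where x: "a x \<noteq> x" using a(2) by (auto simp: fun_eq_iff)
  then have xX: "x \<in> X" "a x \<in> X" using a(1) permutes_not_in permutes_in_image by metis+
  have da: "bij (double a)" using double_permutes[OF a(1)] permutes_bij by blast
  define m where "m = transpose (a x, False) (a x, True) \<circ> transpose (x, False) (x, True)"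
  have m: "m \<in> M"
  proof -
    have "transpose (x, False) (x, True) permutes ?Z"
      using xX by (intro permutes_swap_id) auto
    from comm[OF this] show ?thesis
      unfolding conjugate_transpose[OF da] by (simp add: m_def double_def)
  qed
  have tr: "double (transpose u v) \<in> M" if uv: "u \<in> X" "v \<in> X" "u \<noteq> v" for u v
  proof -
    \<comment> \<open>The two transpositions of \<open>m\<close> exchange the copies of \<open>a x\<close> and those of \<open>x\<close>; \<open>f\<close> sends them to the pairs exchanged by \<open>double (transpose u v)\<close>.\<close>
    define f where "f = (\<lambda>(y, i). (if i then v else u, y \<noteq> a x))"
    obtain \<sigma> where s: "\<sigma> permutes ?Z" "\<And>z. z \<in> {a x, x} \<times> UNIV \<Longrightarrow> \<sigma> z = f z"
    proof (rule permutes_extend[of ?Z "{a x, x} \<times> UNIV" f])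
      show "finite ?Z" using X by simp
      show "{a x, x} \<times> UNIV \<subseteq> ?Z" "f ` ({a x, x} \<times> UNIV) \<subseteq> ?Z"
        using xX uv by (auto simp: f_def)
      show "inj_on f ({a x, x} \<times> UNIV)" using uv x by (auto simp: f_def inj_on_def)
    qed blast
    have bs: "bij \<sigma>" using s(1) permutes_bij by blast
    have "\<sigma> \<circ> m \<circ> inv_into UNIV \<sigma> \<in> M"
      using M.inv_op_closed2[of \<sigma> m] s(1) m by simp
    also have "\<sigma> \<circ> m \<circ> inv_into UNIV \<sigma> =
      (\<sigma> \<circ> transpose (a x, False) (a x, True) \<circ> inv_into UNIV \<sigma>) \<circ>
      (\<sigma> \<circ> transpose (x, False) (x, True) \<circ> inv_into UNIV \<sigma>)"
      using bs by (simp add: m_def fun_eq_iff bij_is_inj)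
    also have "\<dots> = double (transpose u v)"
      unfolding conjugate_transpose[OF bs] using s(2) x uv by (simp add: double_transpose f_def)
    finally show ?thesis .
  qed
  show ?thesis
    using b X
  proof (induction rule: permutes_induct)
    case id
    then show ?case using subgroup.one_closed[OF M.subgroup_axioms] by (simp only: double_id perm_group_simps)
  next
    case (swap u v p)
    then have "double (transpose u v) \<in> M" "double p \<in> M" using tr by blast+
    then show ?case
      using subgroup.m_closed[OF M.subgroup_axioms] by (simp only: double_comp perm_group_simps)
  qed
qed


section \<open>Amalgams of two finite groups\<close>

lemma action_hom_perm_group:
  assumes F: "group F"
    and closed: "\<And>g p. \<lbrakk>g \<in> carrier F; p \<in> X\<rbrakk> \<Longrightarrow> act g p \<in> X"
    and mult: "\<And>g h p. \<lbrakk>g \<in> carrier F; h \<in> carrier F; p \<in> X\<rbrakk> \<Longrightarrow> act (g \<otimes>\<^bsub>F\<^esub> h) p = act g (act h p)"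
    and one: "\<And>p. p \<in> X \<Longrightarrow> act \<one>\<^bsub>F\<^esub> p = p"
  shows "(\<lambda>g p. if p \<in> X then act g p else p) \<in> hom F (perm_group X)"
proof (rule homI)
  interpret group F by (rule F)
  fix g assume g: "g \<in> carrier F"
  have inv: "act (inv\<^bsub>F\<^esub> g) (act g p) = p" "act g (act (inv\<^bsub>F\<^esub> g) p) = p" if "p \<in> X" for p
    using that g mult[of "inv\<^bsub>F\<^esub> g" g p] mult[of g "inv\<^bsub>F\<^esub> g" p] one by simp_all
  have "bij_betw (\<lambda>p. if p \<in> X then act g p else p) X X"
    by (rule bij_betw_byWitness[where f' = "act (inv\<^bsub>F\<^esub> g)"]) (use g inv closed in auto)
  then show "(\<lambda>p. if p \<in> X then act g p else p) \<in> carrier (perm_group X)"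
    by (simp add: bij_imp_permutes)
  fix h assume "h \<in> carrier F"
  then show "(\<lambda>p. if p \<in> X then act (g \<otimes>\<^bsub>F\<^esub> h) p else p) =
    (\<lambda>p. if p \<in> X then act g p else p) \<otimes>\<^bsub>perm_group X\<^esub> (\<lambda>p. if p \<in> X then act h p else p)"
    using g closed mult by (auto simp: fun_eq_iff)
qed

text \<open>
  The element \<open>r x\<close> is a chosen representative of the coset of the image of \<open>h\<close> that contains \<open>x\<close>, and
  \<open>\<gamma> x\<close> is a chosen preimage of the remaining left factor.
\<close>

lemma image_transversal:
  assumes G: "group G" and F: "group F" and h: "h \<in> hom G F"
  obtains r \<gamma> where
    "\<And>x. x \<in> carrier F \<Longrightarrow> r x \<in> carrier F \<and> \<gamma> x \<in> carrier G \<and> h (\<gamma> x) \<otimes>\<^bsub>F\<^esub> r x = x"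
    "\<And>g x. \<lbrakk>g \<in> carrier G; x \<in> carrier F\<rbrakk> \<Longrightarrow> r (h g \<otimes>\<^bsub>F\<^esub> x) = r x"
proof -
  interpret h: group_hom G F h using assms by (simp add: group_hom_def group_hom_axioms_def)
  define C where "C x = (\<lambda>g. h g \<otimes>\<^bsub>F\<^esub> x) ` carrier G" for x
  define r where "r x = (SOME y. y \<in> C x)" for x
  have rC: "r x \<in> C x" if "x \<in> carrier F" for x
    unfolding r_def by (rule someI[of _ "h \<one>\<^bsub>G\<^esub> \<otimes>\<^bsub>F\<^esub> x"]) (unfold C_def, blast)
  have CC: "C (h g \<otimes>\<^bsub>F\<^esub> x) = C x" if g: "g \<in> carrier G" and x: "x \<in> carrier F" for g x
  proof
    show "C (h g \<otimes>\<^bsub>F\<^esub> x) \<subseteq> C x"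
    proof
      fix y assume "y \<in> C (h g \<otimes>\<^bsub>F\<^esub> x)"
      then obtain k where "k \<in> carrier G" "y = h k \<otimes>\<^bsub>F\<^esub> (h g \<otimes>\<^bsub>F\<^esub> x)" by (auto simp: C_def)
      then show "y \<in> C x"
        using g x unfolding C_def by (intro image_eqI[of _ _ "k \<otimes>\<^bsub>G\<^esub> g"]) (auto simp: h.H.m_assoc)
    qed
    show "C x \<subseteq> C (h g \<otimes>\<^bsub>F\<^esub> x)"
    proof
      fix y assume "y \<in> C x"
      then obtain k where k: "k \<in> carrier G" "y = h k \<otimes>\<^bsub>F\<^esub> x" by (auto simp: C_def)
      have "h (k \<otimes>\<^bsub>G\<^esub> inv\<^bsub>G\<^esub> g) \<otimes>\<^bsub>F\<^esub> (h g \<otimes>\<^bsub>F\<^esub> x) = y"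
        using g x k h.hom_mult[of "k \<otimes>\<^bsub>G\<^esub> inv\<^bsub>G\<^esub> g" g]
        by (simp add: h.H.m_assoc[symmetric] h.G.m_assoc del: h.hom_mult)
      then show "y \<in> C (h g \<otimes>\<^bsub>F\<^esub> x)"
        using g k unfolding C_def by (intro image_eqI[of _ _ "k \<otimes>\<^bsub>G\<^esub> inv\<^bsub>G\<^esub> g"]) auto
    qed
  qed
  have "\<exists>g\<in>carrier G. h g \<otimes>\<^bsub>F\<^esub> r x = x" if x: "x \<in> carrier F" for x
  proof -
    obtain k where k: "k \<in> carrier G" "r x = h k \<otimes>\<^bsub>F\<^esub> x" using rC[OF x] by (auto simp: C_def)
    have "h (inv\<^bsub>G\<^esub> k) \<otimes>\<^bsub>F\<^esub> r x = x"
      using k x by (simp add: h.H.m_assoc[symmetric])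
    then show ?thesis using k by blast
  qed
  then obtain \<gamma> where c: "\<And>x. x \<in> carrier F \<Longrightarrow> \<gamma> x \<in> carrier G \<and> h (\<gamma> x) \<otimes>\<^bsub>F\<^esub> r x = x"
    by metis
  have rF: "r x \<in> carrier F" if "x \<in> carrier F" for x
    using rC[OF that] that by (auto simp: C_def)
  have "r (h g \<otimes>\<^bsub>F\<^esub> x) = r x" if "g \<in> carrier G" "x \<in> carrier F" for g x
    using CC[OF that] by (simp add: r_def)
  with c rF show thesis by (intro that[of r \<gamma>] conjI) simp_all
qed

text \<open>
  Both sets are in bijection with the product of the common image of \<open>G\<close> with the two transversals \<open>T1\<close>
  and \<open>T2\<close>, where \<open>G\<close> acts by left multiplication on the first factor. The equality of the kernels is
  what makes the passage from the image in \<open>F1\<close> to the image in \<open>F2\<close> well defined.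
\<close>

lemma equivariant_bijection:
  assumes G: "group G" and F1: "group F1" and F2: "group F2"
    and h1: "h1 \<in> hom G F1" and h2: "h2 \<in> hom G F2"
    and ker: "\<And>g. g \<in> carrier G \<Longrightarrow> h1 g = \<one>\<^bsub>F1\<^esub> \<longleftrightarrow> h2 g = \<one>\<^bsub>F2\<^esub>"
  obtains T1 T2 \<theta> where "T1 \<subseteq> carrier F1" "T2 \<subseteq> carrier F2" "T2 \<noteq> {}"
    "bij_betw \<theta> (carrier F1 \<times> T2) (carrier F2 \<times> T1)"
    "\<And>g x t. \<lbrakk>g \<in> carrier G; x \<in> carrier F1; t \<in> T2\<rbrakk> \<Longrightarrow>
      \<theta> (h1 g \<otimes>\<^bsub>F1\<^esub> x, t) = (h2 g \<otimes>\<^bsub>F2\<^esub> fst (\<theta> (x, t)), snd (\<theta> (x, t)))"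
proof -
  interpret h1: group_hom G F1 h1 using assms by (simp add: group_hom_def group_hom_axioms_def)
  interpret h2: group_hom G F2 h2 using assms by (simp add: group_hom_def group_hom_axioms_def)
  have eq: "h1 a = h1 b \<longleftrightarrow> h2 a = h2 b" if ab: "a \<in> carrier G" "b \<in> carrier G" for a b
  proof -
    have "h1 a = h1 b \<longleftrightarrow> h1 (a \<otimes>\<^bsub>G\<^esub> inv\<^bsub>G\<^esub> b) = \<one>\<^bsub>F1\<^esub>"
      using ab h1.H.inv_solve_right'[of "\<one>\<^bsub>F1\<^esub>" "h1 a" "h1 b"] by auto
    moreover have "h2 a = h2 b \<longleftrightarrow> h2 (a \<otimes>\<^bsub>G\<^esub> inv\<^bsub>G\<^esub> b) = \<one>\<^bsub>F2\<^esub>"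
      using ab h2.H.inv_solve_right'[of "\<one>\<^bsub>F2\<^esub>" "h2 a" "h2 b"] by auto
    ultimately show ?thesis using ker[of "a \<otimes>\<^bsub>G\<^esub> inv\<^bsub>G\<^esub> b"] ab by simp
  qed
  obtain r1 c1 where 1: "\<And>x. x \<in> carrier F1 \<Longrightarrow> r1 x \<in> carrier F1 \<and> c1 x \<in> carrier G \<and> h1 (c1 x) \<otimes>\<^bsub>F1\<^esub> r1 x = x"
    "\<And>g x. \<lbrakk>g \<in> carrier G; x \<in> carrier F1\<rbrakk> \<Longrightarrow> r1 (h1 g \<otimes>\<^bsub>F1\<^esub> x) = r1 x"
    using image_transversal[OF G F1 h1] by metis
  obtain r2 c2 where 2: "\<And>x. x \<in> carrier F2 \<Longrightarrow> r2 x \<in> carrier F2 \<and> c2 x \<in> carrier G \<and> h2 (c2 x) \<otimes>\<^bsub>F2\<^esub> r2 x = x"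
    "\<And>g x. \<lbrakk>g \<in> carrier G; x \<in> carrier F2\<rbrakk> \<Longrightarrow> r2 (h2 g \<otimes>\<^bsub>F2\<^esub> x) = r2 x"
    using image_transversal[OF G F2 h2] by metis
  have rr1: "r1 (r1 x) = r1 x" if "x \<in> carrier F1" for x using 1 that by metis
  have rr2: "r2 (r2 x) = r2 x" if "x \<in> carrier F2" for x using 2 that by metis
  have hc1: "h1 (c1 (h1 g \<otimes>\<^bsub>F1\<^esub> x)) = h1 g \<otimes>\<^bsub>F1\<^esub> h1 (c1 x)"
    if "g \<in> carrier G" "x \<in> carrier F1" for g x
  proof -
    have "h1 (c1 (h1 g \<otimes>\<^bsub>F1\<^esub> x)) \<otimes>\<^bsub>F1\<^esub> r1 x = h1 g \<otimes>\<^bsub>F1\<^esub> x"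
      using 1(1)[of "h1 g \<otimes>\<^bsub>F1\<^esub> x"] 1(2)[OF that] that by simp
    also have "\<dots> = (h1 g \<otimes>\<^bsub>F1\<^esub> h1 (c1 x)) \<otimes>\<^bsub>F1\<^esub> r1 x"
      using 1(1)[OF that(2)] that by (simp add: h1.H.m_assoc)
    finally show ?thesis using 1(1)[OF that(2)] 1(1)[of "h1 g \<otimes>\<^bsub>F1\<^esub> x"] that by simp
  qed
  have hc2: "h2 (c2 (h2 g \<otimes>\<^bsub>F2\<^esub> x)) = h2 g \<otimes>\<^bsub>F2\<^esub> h2 (c2 x)"
    if "g \<in> carrier G" "x \<in> carrier F2" for g x
  proof -
    have "h2 (c2 (h2 g \<otimes>\<^bsub>F2\<^esub> x)) \<otimes>\<^bsub>F2\<^esub> r2 x = h2 g \<otimes>\<^bsub>F2\<^esub> x"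
      using 2(1)[of "h2 g \<otimes>\<^bsub>F2\<^esub> x"] 2(2)[OF that] that by simp
    also have "\<dots> = (h2 g \<otimes>\<^bsub>F2\<^esub> h2 (c2 x)) \<otimes>\<^bsub>F2\<^esub> r2 x"
      using 2(1)[OF that(2)] that by (simp add: h2.H.m_assoc)
    finally show ?thesis using 2(1)[OF that(2)] 2(1)[of "h2 g \<otimes>\<^bsub>F2\<^esub> x"] that by simp
  qed
  define T1 where "T1 = r1 ` carrier F1"
  define T2 where "T2 = r2 ` carrier F2"
  define \<theta> where "\<theta> = (\<lambda>(x, t). (h2 (c1 x) \<otimes>\<^bsub>F2\<^esub> t, r1 x))"
  define \<theta>' where "\<theta>' = (\<lambda>(y, t). (h1 (c2 y) \<otimes>\<^bsub>F1\<^esub> t, r2 y))"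
  have T: "T1 \<subseteq> carrier F1" "T2 \<subseteq> carrier F2" using 1 2 by (auto simp: T1_def T2_def)
  have c_id1: "h1 (c1 t) = \<one>\<^bsub>F1\<^esub>" "r1 t = t" if t: "t \<in> T1" for t
  proof -
    show "r1 t = t" using t rr1 by (auto simp: T1_def)
    then show "h1 (c1 t) = \<one>\<^bsub>F1\<^esub>"
      using 1(1)[of t] t T h1.H.l_cancel_one' by (metis h1.H.r_cancel_one h1.hom_closed subsetD)
  qed
  have c_id2: "h2 (c2 t) = \<one>\<^bsub>F2\<^esub>" "r2 t = t" if t: "t \<in> T2" for t
  proof -
    show "r2 t = t" using t rr2 by (auto simp: T2_def)
    then show "h2 (c2 t) = \<one>\<^bsub>F2\<^esub>"
      using 2(1)[of t] t T h2.H.l_cancel_one' by (metis h2.H.r_cancel_one h2.hom_closed subsetD)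
  qed
  have bij: "bij_betw \<theta> (carrier F1 \<times> T2) (carrier F2 \<times> T1)"
  proof (rule bij_betw_byWitness[where f' = \<theta>'])
    show "\<forall>p\<in>carrier F1 \<times> T2. \<theta>' (\<theta> p) = p"
    proof
      fix p assume "p \<in> carrier F1 \<times> T2"
      then obtain x t where p: "p = (x, t)" "x \<in> carrier F1" "t \<in> T2" by blast
      have tF: "t \<in> carrier F2" using p T by blast
      have "h2 (c2 (h2 (c1 x) \<otimes>\<^bsub>F2\<^esub> t)) = h2 (c1 x)"
        using hc2[of "c1 x" t] c_id2[OF p(3)] 1(1)[OF p(2)] tF by simp
      then have "h1 (c2 (h2 (c1 x) \<otimes>\<^bsub>F2\<^esub> t)) = h1 (c1 x)"
        using eq[of "c2 (h2 (c1 x) \<otimes>\<^bsub>F2\<^esub> t)" "c1 x"] 1(1)[OF p(2)] 2(1)[of "h2 (c1 x) \<otimes>\<^bsub>F2\<^esub> t"] tF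
        by simp
      moreover have "r2 (h2 (c1 x) \<otimes>\<^bsub>F2\<^esub> t) = t"
        using 2(2)[of "c1 x" t] 1(1)[OF p(2)] tF c_id2[OF p(3)] by simp
      ultimately show "\<theta>' (\<theta> p) = p" using 1(1)[OF p(2)] by (simp add: \<theta>_def \<theta>'_def p(1))
    qed
    show "\<forall>p\<in>carrier F2 \<times> T1. \<theta> (\<theta>' p) = p"
    proof
      fix p assume "p \<in> carrier F2 \<times> T1"
      then obtain x t where p: "p = (x, t)" "x \<in> carrier F2" "t \<in> T1" by blast
      have tF: "t \<in> carrier F1" using p T by blast
      have "h1 (c1 (h1 (c2 x) \<otimes>\<^bsub>F1\<^esub> t)) = h1 (c2 x)"
        using hc1[of "c2 x" t] c_id1[OF p(3)] 2(1)[OF p(2)] tF by simp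
      then have "h2 (c1 (h1 (c2 x) \<otimes>\<^bsub>F1\<^esub> t)) = h2 (c2 x)"
        using eq[of "c1 (h1 (c2 x) \<otimes>\<^bsub>F1\<^esub> t)" "c2 x"] 2(1)[OF p(2)] 1(1)[of "h1 (c2 x) \<otimes>\<^bsub>F1\<^esub> t"] tF
        by simp
      moreover have "r1 (h1 (c2 x) \<otimes>\<^bsub>F1\<^esub> t) = t"
        using 1(2)[of "c2 x" t] 2(1)[OF p(2)] tF c_id1[OF p(3)] by simp
      ultimately show "\<theta> (\<theta>' p) = p" using 2(1)[OF p(2)] by (simp add: \<theta>_def \<theta>'_def p(1))
    qed
    show "\<theta> ` (carrier F1 \<times> T2) \<subseteq> carrier F2 \<times> T1"
      using 1 T by (auto simp: \<theta>_def T1_def)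
    show "\<theta>' ` (carrier F2 \<times> T1) \<subseteq> carrier F1 \<times> T2"
      using 2 T by (auto simp: \<theta>'_def T2_def)
  qed
  have "\<theta> (h1 g \<otimes>\<^bsub>F1\<^esub> x, t) = (h2 g \<otimes>\<^bsub>F2\<^esub> fst (\<theta> (x, t)), snd (\<theta> (x, t)))"
    if g: "g \<in> carrier G" and x: "x \<in> carrier F1" and t: "t \<in> T2" for g x t
  proof -
    have cx: "c1 x \<in> carrier G" "c1 (h1 g \<otimes>\<^bsub>F1\<^esub> x) \<in> carrier G"
      using 1(1)[OF x] 1(1)[of "h1 g \<otimes>\<^bsub>F1\<^esub> x"] g x by auto
    have "h1 (c1 (h1 g \<otimes>\<^bsub>F1\<^esub> x)) = h1 (g \<otimes>\<^bsub>G\<^esub> c1 x)"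
      using hc1[OF g x] g cx by simp
    then have "h2 (c1 (h1 g \<otimes>\<^bsub>F1\<^esub> x)) = h2 (g \<otimes>\<^bsub>G\<^esub> c1 x)"
      using eq[of "c1 (h1 g \<otimes>\<^bsub>F1\<^esub> x)" "g \<otimes>\<^bsub>G\<^esub> c1 x"] cx g by simp
    then show ?thesis
      using 1(2)[OF g x] g cx t T by (simp add: \<theta>_def h2.H.m_assoc subsetD)
  qed
  moreover have "T2 \<noteq> {}" unfolding T2_def using h2.H.one_closed by blast
  ultimately show thesis by (intro that[of T1 T2 \<theta>] T bij)
qed

text \<open>
  This is Neumann's permutational product. Let \<open>F1\<close> act on \<open>carrier F1 \<times> T2\<close> by left multiplication and
  let \<open>F2\<close> act on the same set through the equivariant bijection with \<open>carrier F2 \<times> T1\<close>; equivariance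
  says that both actions agree on \<open>G\<close>. Doubling the actions provides the last property.
\<close>

lemma finite_amalgam:
  assumes G: "group G" and F1: "group F1" and F2: "group F2"
    and h1: "h1 \<in> hom G F1" and h2: "h2 \<in> hom G F2"
    and ker: "\<And>g. g \<in> carrier G \<Longrightarrow> h1 g = \<one>\<^bsub>F1\<^esub> \<longleftrightarrow> h2 g = \<one>\<^bsub>F2\<^esub>"
    and fin: "finite (carrier F1)" "finite (carrier F2)"
  obtains Z :: "(('b \<times> 'c) \<times> bool) set" and f1 f2
  where "finite Z" "f1 \<in> hom (F1 :: ('b, 'm) monoid_scheme) (perm_group Z)"
    "f2 \<in> hom (F2 :: ('c, 'n) monoid_scheme) (perm_group Z)"
    "\<And>g. g \<in> carrier G \<Longrightarrow> f1 (h1 g) = f2 (h2 g)"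
    "\<And>x. x \<in> carrier F1 \<Longrightarrow> f1 x = id \<longleftrightarrow> x = \<one>\<^bsub>F1\<^esub>"
    "\<And>x. x \<in> carrier F2 \<Longrightarrow> f2 x = id \<longleftrightarrow> x = \<one>\<^bsub>F2\<^esub>"
    "\<And>M a b. \<lbrakk>M \<lhd> perm_group Z; a \<in> carrier F1; b \<in> carrier F1; a \<noteq> \<one>\<^bsub>F1\<^esub>;
      \<And>s. s permutes Z \<Longrightarrow> f1 a \<circ> s \<circ> inv_into UNIV (f1 a) \<circ> inv_into UNIV s \<in> M\<rbrakk> \<Longrightarrow> f1 b \<in> M"
proof -
  interpret F1: group F1 by (rule F1)
  interpret F2: group F2 by (rule F2)
  obtain T1 T2 \<theta> where T: "T1 \<subseteq> carrier F1" "T2 \<subseteq> carrier F2" "T2 \<noteq> {}"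
    and bij: "bij_betw \<theta> (carrier F1 \<times> T2) (carrier F2 \<times> T1)"
    and equi: "\<And>g x t. \<lbrakk>g \<in> carrier G; x \<in> carrier F1; t \<in> T2\<rbrakk> \<Longrightarrow>
      \<theta> (h1 g \<otimes>\<^bsub>F1\<^esub> x, t) = (h2 g \<otimes>\<^bsub>F2\<^esub> fst (\<theta> (x, t)), snd (\<theta> (x, t)))"
    using equivariant_bijection[OF G F1 F2 h1 h2 ker] by metis
  let ?X = "carrier F1 \<times> T2" and ?Y = "carrier F2 \<times> T1"
  define act1 where "act1 g p = (g \<otimes>\<^bsub>F1\<^esub> fst p, snd p)" for g and p :: "'b \<times> 'c"
  \<comment> \<open>The action of \<open>F2\<close> is transported from \<open>?Y\<close> to \<open>?X\<close> along \<open>\<theta>\<close>.\<close>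
  define act2 where "act2 g p = inv_into ?X \<theta> (g \<otimes>\<^bsub>F2\<^esub> fst (\<theta> p), snd (\<theta> p))" for g p
  have X: "finite ?X" "?X \<noteq> {}" using fin(1) finite_subset[OF T(2) fin(2)] T(3) by auto
  have \<theta>: "\<theta> p \<in> ?Y" "inv_into ?X \<theta> (\<theta> p) = p" if "p \<in> ?X" for p
    using bij that by (auto simp: bij_betw_def)
  have \<theta>': "inv_into ?X \<theta> q \<in> ?X" "\<theta> (inv_into ?X \<theta> q) = q" if "q \<in> ?Y" for q
    using bij that by (auto simp: bij_betw_def inv_into_into f_inv_into_f)
  have moved: "(g \<otimes>\<^bsub>F2\<^esub> fst (\<theta> p), snd (\<theta> p)) \<in> ?Y" if "g \<in> carrier F2" "p \<in> ?X" for g p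
    using \<theta>(1)[OF that(2)] that(1) by (auto simp: mem_Times_iff)
  have \<theta>act2: "\<theta> (act2 g p) = (g \<otimes>\<^bsub>F2\<^esub> fst (\<theta> p), snd (\<theta> p))" if "g \<in> carrier F2" "p \<in> ?X" for g p
    unfolding act2_def using \<theta>'(2)[OF moved[OF that]] .
  define e1 where "e1 g p = (if p \<in> ?X then act1 g p else p)" for g p
  define e2 where "e2 g p = (if p \<in> ?X then act2 g p else p)" for g p
  have e1: "e1 \<in> hom F1 (perm_group ?X)"
    unfolding e1_def by (rule action_hom_perm_group[OF F1]) (auto simp: act1_def F1.m_assoc)
  have e2: "e2 \<in> hom F2 (perm_group ?X)"
    unfolding e2_def
  proof (rule action_hom_perm_group[OF F2])
    show act2_X: "act2 g p \<in> ?X" if "g \<in> carrier F2" "p \<in> ?X" for g p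
      unfolding act2_def using \<theta>'(1)[OF moved[OF that]] .
    show "act2 (g \<otimes>\<^bsub>F2\<^esub> h) p = act2 g (act2 h p)"
      if "g \<in> carrier F2" "h \<in> carrier F2" "p \<in> ?X" for g h p
      using \<theta>act2[OF that(2,3)] \<theta>(1)[OF that(3)] that(1,2)
      by (simp add: act2_def[of "g \<otimes>\<^bsub>F2\<^esub> h"] act2_def[of g] F2.m_assoc mem_Times_iff)
    show "act2 \<one>\<^bsub>F2\<^esub> p = p" if "p \<in> ?X" for p
      using \<theta>[OF that] by (simp add: act2_def mem_Times_iff)
  qed
  define f1 where "f1 g = double (e1 g)" for g
  define f2 where "f2 g = double (e2 g)" for g
  have p1: "e1 g permutes ?X" if "g \<in> carrier F1" for g
    using hom_in_carrier[OF e1 that] by simp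
  have p2: "e2 g permutes ?X" if "g \<in> carrier F2" for g
    using hom_in_carrier[OF e2 that] by simp
  have inj1: "e1 g = id \<longleftrightarrow> g = \<one>\<^bsub>F1\<^esub>" if g: "g \<in> carrier F1" for g
  proof
    assume "e1 g = id"
    obtain t where t: "t \<in> T2" using T by blast
    have "e1 g (\<one>\<^bsub>F1\<^esub>, t) = (\<one>\<^bsub>F1\<^esub>, t)" using \<open>e1 g = id\<close> by simp
    then show "g = \<one>\<^bsub>F1\<^esub>" using g t by (simp add: e1_def act1_def)
  next
    assume "g = \<one>\<^bsub>F1\<^esub>"
    then show "e1 g = id" by (auto simp: e1_def act1_def)
  qed
  have inj2: "e2 g = id \<longleftrightarrow> g = \<one>\<^bsub>F2\<^esub>" if g: "g \<in> carrier F2" for g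
  proof
    assume e: "e2 g = id"
    obtain p where p: "p \<in> ?X" using X by blast
    have "act2 g p = p" using e p by (metis e2_def id_apply)
    then have "g \<otimes>\<^bsub>F2\<^esub> fst (\<theta> p) = fst (\<theta> p)" using \<theta>act2[OF g p] by (metis fst_conv)
    then show "g = \<one>\<^bsub>F2\<^esub>" using g \<theta>(1)[OF p] by (simp add: mem_Times_iff)
  next
    assume "g = \<one>\<^bsub>F2\<^esub>"
    then show "e2 g = id" using \<theta> by (auto simp: e2_def act2_def mem_Times_iff)
  qed
  have double_eq_id: "double p = id \<longleftrightarrow> p = id" for p :: "'b \<times> 'c \<Rightarrow> 'b \<times> 'c"
    by (auto simp: double_def fun_eq_iff)
  have agree: "e1 (h1 g) = e2 (h2 g)" if g: "g \<in> carrier G" for g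
  proof
    fix p show "e1 (h1 g) p = e2 (h2 g) p"
    proof (cases "p \<in> ?X")
      case True
      have "act1 (h1 g) p \<in> ?X" using True hom_in_carrier[OF h1 g] by (auto simp: act1_def)
      moreover have "\<theta> (act1 (h1 g) p) = (h2 g \<otimes>\<^bsub>F2\<^esub> fst (\<theta> p), snd (\<theta> p))"
        using True equi[OF g] by (auto simp: act1_def)
      ultimately have "act1 (h1 g) p = act2 (h2 g) p"
        unfolding act2_def by (metis \<theta>(2))
      then show ?thesis using True by (simp add: e1_def e2_def)
    next
      case False
      then show ?thesis unfolding e1_def e2_def by simp
    qed
  qed
  show thesis
  proof (rule that[of "?X \<times> UNIV" f1 f2])
    show "finite (?X \<times> (UNIV :: bool set))" using X by simp
    show "f1 \<in> hom F1 (perm_group (?X \<times> UNIV))"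
      using e1 p1 by (auto simp: hom_def f1_def double_permutes double_comp)
    show "f2 \<in> hom F2 (perm_group (?X \<times> UNIV))"
      using e2 p2 by (auto simp: hom_def f2_def double_permutes double_comp)
    show "f1 (h1 g) = f2 (h2 g)" if "g \<in> carrier G" for g
      using agree[OF that] by (simp add: f1_def f2_def)
    show "f1 x = id \<longleftrightarrow> x = \<one>\<^bsub>F1\<^esub>" if "x \<in> carrier F1" for x
      using inj1[OF that] by (simp add: f1_def double_eq_id)
    show "f2 x = id \<longleftrightarrow> x = \<one>\<^bsub>F2\<^esub>" if "x \<in> carrier F2" for x
      using inj2[OF that] by (simp add: f2_def double_eq_id)
    show "f1 b \<in> M" if M: "M \<lhd> perm_group (?X \<times> UNIV)" and ab: "a \<in> carrier F1" "b \<in> carrier F1" "a \<noteq> \<one>\<^bsub>F1\<^esub>"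
      and comm: "\<And>s. s permutes ?X \<times> UNIV \<Longrightarrow> f1 a \<circ> s \<circ> inv_into UNIV (f1 a) \<circ> inv_into UNIV s \<in> M" for M a b
      unfolding f1_def
      by (rule double_in_normal_subgroup[OF X(1) M p1[OF ab(1)] _ p1[OF ab(2)]])
        (use inj1 ab comm in \<open>auto simp: f1_def\<close>)
  qed
qed

lemma normal_preimage:
  assumes G: "group G" and H: "group H" and f: "f \<in> hom G H" and M: "M \<lhd> H"
  shows "{x \<in> carrier G. f x \<in> M} \<lhd> G"
proof -
  interpret f: group_hom G H f using assms by (simp add: group_hom_def group_hom_axioms_def)
  interpret M: normal M H by (rule M)
  note sM = M.subgroup_axioms
  have "subgroup {x \<in> carrier G. f x \<in> M} G"
    by (rule f.G.subgroupI)
      (auto intro: subgroup.m_inv_closed[OF sM] subgroup.m_closed[OF sM] exI[of _ "\<one>\<^bsub>G\<^esub>"]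
        simp: subgroup.one_closed[OF sM])
  then show ?thesis
    unfolding f.G.normal_inv_iff by (auto simp: M.inv_op_closed2)
qed

text \<open>
  The condition on the kernels says that the images of \<open>G\<close> in the two quotient groups are isomorphic over
  \<open>G\<close>, so that the quotients can be amalgamated.
\<close>

lemma amalgam_mod_normal_subgroups:
  fixes G1 :: "('b, 'm) monoid_scheme" and G2 :: "('c, 'n) monoid_scheme"
  assumes G: "group G" and G1: "group G1" and G2: "group G2"
    and e1: "e1 \<in> hom G G1" and e2: "e2 \<in> hom G G2"
    and N: "N1 \<lhd> G1" "N2 \<lhd> G2"
    and ker: "\<And>g. g \<in> carrier G \<Longrightarrow> e1 g \<in> N1 \<longleftrightarrow> e2 g \<in> N2"
    and fin: "finite (carrier G1)" "finite (carrier G2)"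
  obtains Z :: "(('b set \<times> 'c set) \<times> bool) set" and f1 f2
  where "finite Z" "f1 \<in> hom G1 (perm_group Z)" "f2 \<in> hom G2 (perm_group Z)"
    "\<And>g. g \<in> carrier G \<Longrightarrow> f1 (e1 g) = f2 (e2 g)"
    "\<And>x. x \<in> carrier G1 \<Longrightarrow> f1 x = id \<longleftrightarrow> x \<in> N1"
    "\<And>x. x \<in> carrier G2 \<Longrightarrow> f2 x = id \<longleftrightarrow> x \<in> N2"
    "\<And>M a b. \<lbrakk>M \<lhd> perm_group Z; a \<in> carrier G1; b \<in> carrier G1; a \<notin> N1;
      \<And>s. s permutes Z \<Longrightarrow> f1 a \<circ> s \<circ> inv_into UNIV (f1 a) \<circ> inv_into UNIV s \<in> M\<rbrakk> \<Longrightarrow> f1 b \<in> M"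
proof -
  interpret N1: normal N1 G1 by (rule N)
  interpret N2: normal N2 G2 by (rule N)
  define q1 where "q1 x = N1 #>\<^bsub>G1\<^esub> x" for x
  define q2 where "q2 x = N2 #>\<^bsub>G2\<^esub> x" for x
  have q1: "q1 \<in> hom G1 (G1 Mod N1)" and q2: "q2 \<in> hom G2 (G2 Mod N2)"
    unfolding q1_def q2_def by (rule N1.r_coset_hom_Mod N2.r_coset_hom_Mod)+
  have k1: "q1 x = \<one>\<^bsub>G1 Mod N1\<^esub> \<longleftrightarrow> x \<in> N1" if "x \<in> carrier G1" for x
    using N1.coset_join1[OF _ that N1.subgroup_axioms] N1.coset_join2[OF that N1.subgroup_axioms]
    by (auto simp: q1_def FactGroup_def)
  have k2: "q2 x = \<one>\<^bsub>G2 Mod N2\<^esub> \<longleftrightarrow> x \<in> N2" if "x \<in> carrier G2" for x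
    using N2.coset_join1[OF _ that N2.subgroup_axioms] N2.coset_join2[OF that N2.subgroup_axioms]
    by (auto simp: q2_def FactGroup_def)
  have h1: "q1 \<circ> e1 \<in> hom G (G1 Mod N1)" and h2: "q2 \<circ> e2 \<in> hom G (G2 Mod N2)"
    using hom_compose[OF e1 q1] hom_compose[OF e2 q2] .
  have f: "finite (carrier (G1 Mod N1))" "finite (carrier (G2 Mod N2))"
    using fin by (auto simp: FactGroup_def RCOSETS_def)
  have ker': "(q1 \<circ> e1) g = \<one>\<^bsub>G1 Mod N1\<^esub> \<longleftrightarrow> (q2 \<circ> e2) g = \<one>\<^bsub>G2 Mod N2\<^esub>" if "g \<in> carrier G" for g
    using k1[of "e1 g"] k2[of "e2 g"] ker[OF that] hom_in_carrier[OF e1 that] hom_in_carrier[OF e2 that]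
    by simp
  show thesis
  proof (rule finite_amalgam[OF G N1.factorgroup_is_group N2.factorgroup_is_group h1 h2 ker' f])
    fix Z :: "(('b set \<times> 'c set) \<times> bool) set" and f1 f2
    assume Z: "finite Z" "f1 \<in> hom (G1 Mod N1) (perm_group Z)" "f2 \<in> hom (G2 Mod N2) (perm_group Z)"
      and agree: "\<And>g. g \<in> carrier G \<Longrightarrow> f1 ((q1 \<circ> e1) g) = f2 ((q2 \<circ> e2) g)"
      and i1: "\<And>x. x \<in> carrier (G1 Mod N1) \<Longrightarrow> f1 x = id \<longleftrightarrow> x = \<one>\<^bsub>G1 Mod N1\<^esub>"
      and i2: "\<And>x. x \<in> carrier (G2 Mod N2) \<Longrightarrow> f2 x = id \<longleftrightarrow> x = \<one>\<^bsub>G2 Mod N2\<^esub>"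
      and M: "\<And>M a b. \<lbrakk>M \<lhd> perm_group Z; a \<in> carrier (G1 Mod N1); b \<in> carrier (G1 Mod N1);
        a \<noteq> \<one>\<^bsub>G1 Mod N1\<^esub>;
        \<And>s. s permutes Z \<Longrightarrow> f1 a \<circ> s \<circ> inv_into UNIV (f1 a) \<circ> inv_into UNIV s \<in> M\<rbrakk> \<Longrightarrow> f1 b \<in> M"
    show thesis
  proof (rule that[of Z "f1 \<circ> q1" "f2 \<circ> q2"])
    show "f1 \<circ> q1 \<in> hom G1 (perm_group Z)" "f2 \<circ> q2 \<in> hom G2 (perm_group Z)"
      using hom_compose[OF q1 Z(2)] hom_compose[OF q2 Z(3)] .
    show "(f1 \<circ> q1) x = id \<longleftrightarrow> x \<in> N1" if "x \<in> carrier G1" for x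
      unfolding comp_apply i1[OF hom_in_carrier[OF q1 that]] k1[OF that] ..
    show "(f2 \<circ> q2) x = id \<longleftrightarrow> x \<in> N2" if "x \<in> carrier G2" for x
      unfolding comp_apply i2[OF hom_in_carrier[OF q2 that]] k2[OF that] ..
    show "(f1 \<circ> q1) b \<in> M" if M': "M \<lhd> perm_group Z" and ab: "a \<in> carrier G1" "b \<in> carrier G1" "a \<notin> N1"
      and comm: "\<And>s. s permutes Z \<Longrightarrow>
        (f1 \<circ> q1) a \<circ> s \<circ> inv_into UNIV ((f1 \<circ> q1) a) \<circ> inv_into UNIV s \<in> M" for M a b
    proof -
      have "q1 a \<noteq> \<one>\<^bsub>G1 Mod N1\<^esub>" using k1[OF ab(1)] ab(3) by argo
      then have "f1 (q1 b) \<in> M"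
        by (rule M[OF M' hom_in_carrier[OF q1 ab(1)] hom_in_carrier[OF q1 ab(2)] _ comm[unfolded comp_apply[of f1 q1]]])
      then show ?thesis unfolding comp_apply[of f1 q1] .
    qed
  qed (use Z(1) agree in simp_all)
  qed
qed

section \<open>Valued groups\<close>

definition single :: "'i set \<Rightarrow> ('i \<Rightarrow> ('b, 'm) monoid_scheme) \<Rightarrow> 'i \<Rightarrow> 'b \<Rightarrow> 'i \<Rightarrow> 'b"
  where "single I S d s = (\<lambda>i\<in>I. if i = d then s else \<one>\<^bsub>S i\<^esub>)"

lemma single_hom:
  assumes "\<And>i. i \<in> I \<Longrightarrow> group (S i)" "d \<in> I"
  shows "single I S d \<in> hom (S d) (product_group I S)"
proof (rule homI)
  fix s assume "s \<in> carrier (S d)"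
  then show "single I S d s \<in> carrier (product_group I S)"
    using assms by (auto simp: single_def group.is_monoid)
  fix t assume "t \<in> carrier (S d)"
  show "single I S d (s \<otimes>\<^bsub>S d\<^esub> t) = single I S d s \<otimes>\<^bsub>product_group I S\<^esub> single I S d t"
    using assms by (auto simp: single_def group.is_monoid fun_eq_iff restrict_def)
qed

text \<open>An element of a finite product is the product of its components.\<close>

lemma product_in_subgroup_of_singles:
  assumes S: "\<And>i. i \<in> I \<Longrightarrow> group (S i)" and I: "finite I"
    and M: "subgroup M (product_group I S)"
    and p: "p \<in> carrier (product_group I S)"
    and single: "\<And>d. d \<in> I \<Longrightarrow> single I S d (p d) \<in> M"
  shows "p \<in> M"
proof -
  have "(\<lambda>i\<in>I. if i \<in> J then p i else \<one>\<^bsub>S i\<^esub>) \<in> M" if "finite J" "J \<subseteq> I" for J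
    using that
  proof (induction J)
    case empty
    then show ?case using subgroup.one_closed[OF M] by (simp add: restrict_def)
  next
    case (insert d J)
    have "single I S d (p d) \<otimes>\<^bsub>product_group I S\<^esub> (\<lambda>i\<in>I. if i \<in> J then p i else \<one>\<^bsub>S i\<^esub>) \<in> M"
      using insert.IH insert.prems single by (intro subgroup.m_closed[OF M]) blast+
    also have "single I S d (p d) \<otimes>\<^bsub>product_group I S\<^esub> (\<lambda>i\<in>I. if i \<in> J then p i else \<one>\<^bsub>S i\<^esub>) =
      (\<lambda>i\<in>I. if i \<in> insert d J then p i else \<one>\<^bsub>S i\<^esub>)"
    proof
      fix i
      have "i \<in> I \<Longrightarrow> monoid (S i)" "i \<in> I \<Longrightarrow> p i \<in> carrier (S i)"
        using S p by (auto simp: group.is_monoid)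
      then show "(single I S d (p d) \<otimes>\<^bsub>product_group I S\<^esub> (\<lambda>i\<in>I. if i \<in> J then p i else \<one>\<^bsub>S i\<^esub>)) i =
        (\<lambda>i\<in>I. if i \<in> insert d J then p i else \<one>\<^bsub>S i\<^esub>) i"
        using insert by (auto simp: single_def monoid.r_one monoid.l_one monoid.one_closed)
    qed
    finally show ?case .
  qed
  from this[OF I subset_refl] have "(\<lambda>i\<in>I. p i) \<in> M"
    by (simp cong: restrict_cong)
  then show ?thesis using p by (simp add: PiE_def extensional_restrict)
qed

context distributive_algebraic_lattice
begin

text \<open>
  The laws \<open>\<mu> (x \<otimes> y) \<sqsubseteq> \<mu> x \<squnion> \<mu> y\<close> and \<open>\<mu> (inv x) = \<mu> x\<close> as well as invariance under conjugation are
  summed up in the normality of the sets \<open>{x. \<mu> x \<sqsubseteq> d}\<close>.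
\<close>

definition valued :: "('g, 'm) monoid_scheme \<Rightarrow> ('g \<Rightarrow> 'a) \<Rightarrow> bool"
  where "valued G \<mu> \<longleftrightarrow> group G \<and> (\<forall>x\<in>carrier G. \<mu> x \<in> compact_elements L) \<and>
    (\<forall>d\<in>carrier L. {x \<in> carrier G. \<mu> x \<sqsubseteq> d} \<lhd> G) \<and>
    (\<forall>x\<in>carrier G. \<mu> x = \<Squnion>{} \<longrightarrow> x = \<one>\<^bsub>G\<^esub>)"

text \<open>
  Injectivity is automatic, since an element of the kernel has the value of the identity. The relation
  \<open>embeds id\<close> says that the first valued group is a valued subgroup of the second.
\<close>

definition embeds :: "('g \<Rightarrow> 'h) \<Rightarrow> ('g, 'm) monoid_scheme \<Rightarrow> ('g \<Rightarrow> 'a) \<Rightarrow>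
    ('h, 'n) monoid_scheme \<Rightarrow> ('h \<Rightarrow> 'a) \<Rightarrow> bool"
  where "embeds f G \<mu> H \<nu> \<longleftrightarrow> f \<in> hom G H \<and> (\<forall>x\<in>carrier G. \<nu> (f x) = \<mu> x)"

text \<open>
  Quantifying over the normal subgroups \<open>M\<close> that contain \<open>f ` Y\<close> expresses that \<open>f x\<close> belongs to the normal
  closure of \<open>f ` Y\<close> in \<open>H\<close>.
\<close>

definition separates :: "('g \<Rightarrow> 'h) \<Rightarrow> ('g, 'm) monoid_scheme \<Rightarrow> ('g \<Rightarrow> 'a) \<Rightarrow>
    ('h, 'n) monoid_scheme \<Rightarrow> bool"
  where "separates f G \<mu> H \<longleftrightarrow> (\<forall>M Y x. M \<lhd> H \<longrightarrow> finite Y \<longrightarrow> Y \<subseteq> carrier G \<longrightarrow> x \<in> carrier G \<longrightarrow>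
    f ` Y \<subseteq> M \<longrightarrow> \<mu> x \<sqsubseteq> \<Squnion>(\<mu> ` Y) \<longrightarrow> f x \<in> M)"

lemma valuedD:
  assumes v: "valued G \<mu>"
  shows "group G" "x \<in> carrier G \<Longrightarrow> \<mu> x \<in> compact_elements L" "x \<in> carrier G \<Longrightarrow> \<mu> x \<in> carrier L"
    "d \<in> carrier L \<Longrightarrow> {x \<in> carrier G. \<mu> x \<sqsubseteq> d} \<lhd> G"
    "\<lbrakk>x \<in> carrier G; \<mu> x = \<Squnion>{}\<rbrakk> \<Longrightarrow> x = \<one>\<^bsub>G\<^esub>"
proof -
  note * = v[unfolded valued_def]
  show "group G" using * by (rule conjunct1)
  show c: "x \<in> carrier G \<Longrightarrow> \<mu> x \<in> compact_elements L"
    by (rule *[THEN conjunct2, THEN conjunct1, rule_format])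
  then show "x \<in> carrier G \<Longrightarrow> \<mu> x \<in> carrier L" by (rule compact_carrier)
  show "d \<in> carrier L \<Longrightarrow> {x \<in> carrier G. \<mu> x \<sqsubseteq> d} \<lhd> G"
    by (rule *[THEN conjunct2, THEN conjunct2, THEN conjunct1, rule_format])
  show "\<lbrakk>x \<in> carrier G; \<mu> x = \<Squnion>{}\<rbrakk> \<Longrightarrow> x = \<one>\<^bsub>G\<^esub>"
    by (rule *[THEN conjunct2, THEN conjunct2, THEN conjunct2, rule_format])
qed

text \<open>
  An element has value \<open>\<sqsubseteq> e\<close> iff its coordinates of weight \<open>\<not> \<sqsubseteq> e\<close> are trivial, so these elements form the
  kernel of a projection.
\<close>

lemma valued_product:
  assumes I: "finite I" and S: "\<And>i. i \<in> I \<Longrightarrow> group (S i)"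
    and c: "\<And>i. i \<in> I \<Longrightarrow> c i \<in> compact_elements L \<and> c i \<noteq> \<Squnion>{}"
  shows "valued (product_group I S) (\<lambda>p. \<Squnion>(c ` {i \<in> I. p i \<noteq> \<one>\<^bsub>S i\<^esub>}))"
  unfolding valued_def
proof (intro conjI ballI impI)
  let ?P = "product_group I S" and ?\<pi> = "\<lambda>p. \<Squnion>(c ` {i \<in> I. p i \<noteq> \<one>\<^bsub>S i\<^esub>})"
  show P: "group ?P" using S by simp
  interpret P: group ?P by (rule P)
  have cL: "c ` A \<subseteq> carrier L" if "A \<subseteq> I" for A using c compact_carrier that by blast
  show "?\<pi> p \<in> compact_elements L" for p
    using I c by (intro compact_Sup) auto
  have le: "?\<pi> p \<sqsubseteq> e \<longleftrightarrow> (\<forall>i\<in>I. p i \<noteq> \<one>\<^bsub>S i\<^esub> \<longrightarrow> c i \<sqsubseteq> e)" if "e \<in> carrier L" for p e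
    using that cL by (subst sup_le_iff) auto
  show "p = \<one>\<^bsub>?P\<^esub>" if p: "p \<in> carrier ?P" and "?\<pi> p = \<Squnion>{}" for p
  proof -
    have "p i = \<one>\<^bsub>S i\<^esub>" if i: "i \<in> I" for i
    proof (rule ccontr)
      assume "p i \<noteq> \<one>\<^bsub>S i\<^esub>"
      then have "c i \<sqsubseteq> ?\<pi> p" using i cL by (intro sup_upper) auto
      then have "c i \<sqsubseteq> \<Squnion>{}" using \<open>?\<pi> p = \<Squnion>{}\<close> by simp
      then show False using c[OF i] compact_carrier le_bottom_iff by blast
    qed
    then show ?thesis using p by (auto simp: fun_eq_iff PiE_def extensional_def)
  qed
  fix e assume e: "e \<in> carrier L"
  have *: "{p \<in> carrier ?P. ?\<pi> p \<sqsubseteq> e} =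
    {p \<in> carrier ?P. \<forall>i\<in>I. \<not> c i \<sqsubseteq> e \<longrightarrow> p i = \<one>\<^bsub>S i\<^esub>}" (is "_ = ?N")
    using le[OF e] by blast
  have mon: "\<And>i. i \<in> I \<Longrightarrow> monoid (S i)" using S group.is_monoid by blast
  have invP: "inv\<^bsub>?P\<^esub> p = (\<lambda>i\<in>I. inv\<^bsub>S i\<^esub> p i)" if "p \<in> carrier ?P" for p
    using that S by (intro inv_product_group) auto
  have "subgroup ?N ?P"
  proof (rule P.subgroupI)
    show "?N \<noteq> {}" using P.one_closed mon by (intro ex_in_conv[THEN iffD1] exI[of _ "\<one>\<^bsub>?P\<^esub>"]) auto
    show "inv\<^bsub>?P\<^esub> p \<in> ?N" if "p \<in> ?N" for p
      using that P.inv_closed[of p] mon by (auto simp: invP monoid.inv_one)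
    show "p \<otimes>\<^bsub>?P\<^esub> q \<in> ?N" if "p \<in> ?N" "q \<in> ?N" for p q
      using that P.m_closed[of p q] mon by (auto simp: monoid.l_one)
  qed auto
  moreover have "x \<otimes>\<^bsub>?P\<^esub> p \<otimes>\<^bsub>?P\<^esub> inv\<^bsub>?P\<^esub> x \<in> ?N" if x: "x \<in> carrier ?P" and p: "p \<in> ?N" for x p
  proof -
    have "x \<otimes>\<^bsub>?P\<^esub> p \<otimes>\<^bsub>?P\<^esub> inv\<^bsub>?P\<^esub> x \<in> carrier ?P"
      using x p by (intro P.m_closed P.inv_closed) auto
    moreover have "(x \<otimes>\<^bsub>?P\<^esub> p \<otimes>\<^bsub>?P\<^esub> inv\<^bsub>?P\<^esub> x) i = \<one>\<^bsub>S i\<^esub>" if "i \<in> I" "\<not> c i \<sqsubseteq> e" for i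
    proof -
      have "x i \<in> carrier (S i)" "p i = \<one>\<^bsub>S i\<^esub>" using x p that by auto
      then show ?thesis
        using that S[OF that(1)] x by (simp add: invP group.r_inv monoid.r_one mon)
    qed
    ultimately show ?thesis by blast
  qed
  ultimately show "{p \<in> carrier ?P. ?\<pi> p \<sqsubseteq> e} \<lhd> ?P"
    unfolding * P.normal_inv_iff by blast
qed

lemma embedsD:
  assumes "embeds f G \<mu> H \<nu>"
  shows "f \<in> hom G H" "x \<in> carrier G \<Longrightarrow> f x \<in> carrier H" "x \<in> carrier G \<Longrightarrow> \<nu> (f x) = \<mu> x"
    "\<lbrakk>x \<in> carrier G; y \<in> carrier G\<rbrakk> \<Longrightarrow> f (x \<otimes>\<^bsub>G\<^esub> y) = f x \<otimes>\<^bsub>H\<^esub> f y"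
  using assms by (auto simp: embeds_def hom_def)

lemma embeds_trans:
  assumes "embeds f G \<mu> H \<nu>" "embeds g H \<nu> K \<kappa>"
  shows "embeds (g \<circ> f) G \<mu> K \<kappa>"
  using assms unfolding embeds_def by (auto intro: hom_compose dest: hom_in_carrier)

lemma embeds_refl: "embeds id G \<mu> G \<mu>"
  by (simp add: embeds_def hom_def)

lemma embeds_id_subset:
  assumes "embeds id G \<mu> H \<nu>"
  shows "carrier G \<subseteq> carrier H"
  using embedsD(2)[OF assms] by auto

lemma embeds_id_trans:
  assumes "embeds id G \<mu> H \<nu>" "embeds id H \<nu> K \<kappa>"
  shows "embeds id G \<mu> K \<kappa>"
  using embeds_trans[OF assms] by (simp only: id_comp)

lemma embeds_cong:
  assumes "embeds f G \<mu> H \<nu>" "\<And>x. x \<in> carrier G \<Longrightarrow> g x = f x" "group G"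
  shows "embeds g G \<mu> H \<nu>"
  using assms group.is_monoid[OF assms(3)] unfolding embeds_def hom_def
  by (auto simp: monoid.m_closed)

lemma separates_cong:
  assumes "separates f G \<mu> H" "\<And>x. x \<in> carrier G \<Longrightarrow> g x = f x"
  shows "separates g G \<mu> H"
  unfolding separates_def
proof (intro allI impI)
  fix M Y x assume *: "M \<lhd> H" "finite Y" "Y \<subseteq> carrier G" "x \<in> carrier G" "g ` Y \<subseteq> M" "\<mu> x \<sqsubseteq> \<Squnion>(\<mu> ` Y)"
  have "f ` Y = g ` Y" using assms(2) *(3) by (intro image_cong) auto
  then have "f x \<in> M" using assms(1)[unfolded separates_def, rule_format, of M Y x] * by simp
  then show "g x \<in> M" using assms(2) *(4) by simp
qed

lemma separates_comp:
  assumes f: "f \<in> carrier G \<rightarrow> carrier H" and s: "separates f G \<mu> H" and H: "group H" and K: "group K"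
    and g: "g \<in> hom H K"
  shows "separates (g \<circ> f) G \<mu> K"
  unfolding separates_def
proof (intro allI impI)
  fix M Y x assume *: "M \<lhd> K" "finite Y" "Y \<subseteq> carrier G" "x \<in> carrier G" "(g \<circ> f) ` Y \<subseteq> M" "\<mu> x \<sqsubseteq> \<Squnion>(\<mu> ` Y)"
  have "{y \<in> carrier H. g y \<in> M} \<lhd> H" using normal_preimage[OF H K g *(1)] .
  moreover have "f ` Y \<subseteq> {y \<in> carrier H. g y \<in> M}" using *(3,5) f by auto
  ultimately have "f x \<in> {y \<in> carrier H. g y \<in> M}"
    using s[unfolded separates_def, rule_format, of "{y \<in> carrier H. g y \<in> M}" Y x] *(2,3,4,6) by simp
  then show "(g \<circ> f) x \<in> M" by simp
qed

lemma separates_surj: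
  assumes P: "group P" "group H" and s: "separates id P \<pi> P" and h: "embeds h P \<pi> H \<nu>"
    and surj: "h ` carrier P = carrier H"
  shows "separates id H \<nu> H"
  unfolding separates_def
proof (intro allI impI)
  fix M Y x assume *: "M \<lhd> H" "finite Y" "Y \<subseteq> carrier H" "x \<in> carrier H" "id ` Y \<subseteq> M" "\<nu> x \<sqsubseteq> \<Squnion>(\<nu> ` Y)"
  obtain B where B: "B \<subseteq> carrier P" "finite B" "Y = h ` B"
    using finite_subset_image[of Y h "carrier P"] surj *(2,3) by auto
  obtain z where z: "z \<in> carrier P" "x = h z" using surj *(4) by auto
  have "separates (h \<circ> id) P \<pi> H"
    using P embedsD(1)[OF h] s by (intro separates_comp) auto
  moreover have "(h \<circ> id) ` B \<subseteq> M" using B *(5) by auto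
  moreover have "\<pi> ` B = \<nu> ` Y" unfolding B(3) image_image
    using embedsD(3)[OF h] B(1) by (intro image_cong) auto
  then have "\<pi> z \<sqsubseteq> \<Squnion>(\<pi> ` B)" using *(6) z embedsD(3)[OF h, of z] by simp
  ultimately show "id x \<in> M"
    unfolding separates_def using *(1) B z by simp
qed

lemma valued_one:
  assumes G: "valued G \<mu>"
  shows "\<mu> \<one>\<^bsub>G\<^esub> = \<Squnion>{}"
proof -
  interpret group G by (rule valuedD(1)[OF G])
  have "subgroup {x \<in> carrier G. \<mu> x \<sqsubseteq> \<Squnion>{}} G"
    by (intro normal_imp_subgroup valuedD(4)[OF G] sup_closed) simp
  then have "\<one>\<^bsub>G\<^esub> \<in> {x \<in> carrier G. \<mu> x \<sqsubseteq> \<Squnion>{}}" by (rule subgroup.one_closed)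
  then show ?thesis using le_bottom_iff[OF valuedD(3)[OF G]] by simp
qed

lemma valued_pullback:
  assumes P: "valued P \<pi>" and H: "group H" and g: "g \<in> hom H P" and inj: "inj_on g (carrier H)"
  shows "valued H (\<lambda>x. \<pi> (g x))"
  unfolding valued_def
proof (intro conjI ballI impI)
  note P' = valuedD[OF P]
  interpret g: group_hom H P g using P' H g by (simp add: group_hom_def group_hom_axioms_def)
  fix x assume x: "x \<in> carrier H"
  then show "\<pi> (g x) \<in> compact_elements L" using P'(2) g.hom_closed by blast
  assume "\<pi> (g x) = \<Squnion>{}"
  then have "g x = \<one>\<^bsub>P\<^esub>" using P'(5) x g.hom_closed by blast
  then show "x = \<one>\<^bsub>H\<^esub>" using inj_onD[OF inj, of x "\<one>\<^bsub>H\<^esub>"] x by simp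
next
  fix d assume "d \<in> carrier L"
  then have "{x \<in> carrier H. g x \<in> {y \<in> carrier P. \<pi> y \<sqsubseteq> d}} \<lhd> H"
    by (intro normal_preimage[OF H valuedD(1)[OF P] g] valuedD(4)[OF P])
  moreover have "{x \<in> carrier H. g x \<in> {y \<in> carrier P. \<pi> y \<sqsubseteq> d}} = {x \<in> carrier H. \<pi> (g x) \<sqsubseteq> d}"
    using hom_in_carrier[OF g] by blast
  ultimately show "{x \<in> carrier H. \<pi> (g x) \<sqsubseteq> d} \<lhd> H" by simp
qed (rule H)

lemma valued_image:
  assumes P: "valued P \<pi>" and h: "inj_on h (carrier P)"
  obtains H :: "'h monoid" and \<nu> where "valued H \<nu>" "carrier H = h ` carrier P" "embeds h P \<pi> H \<nu>"
proof -
  let ?H = "image_group h P"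
  note P' = valuedD[OF P]
  have H: "group ?H" using group.inj_imp_image_group_is_group[OF P'(1) h] .
  have iso: "h \<in> iso P ?H" using inj_imp_image_group_iso[OF h] .
  then have inv: "inv_into (carrier P) h \<in> iso ?H P" using P'(1) by (rule group.iso_set_sym[rotated])
  show thesis
  proof (rule that)
    show "valued ?H (\<lambda>x. \<pi> (inv_into (carrier P) h x))"
      using inv by (intro valued_pullback[OF P H]) (auto simp: iso_def bij_betw_def)
    show "carrier ?H = h ` carrier P" by (rule image_group_carrier)
    show "embeds h P \<pi> ?H (\<lambda>x. \<pi> (inv_into (carrier P) h x))"
      using iso h by (auto simp: embeds_def iso_def)
  qed
qed

text \<open>
  This turns an embedding into an inclusion: the elements of \<open>P\<close> outside the image of \<open>f\<close> are renamed by
  \<open>j\<close>, which avoids \<open>G\<close>. It keeps all groups of a chain inside one type.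
\<close>

lemma rename_extension:
  fixes G :: "('g, 'm) monoid_scheme"
  assumes G: "valued G \<mu>" and P: "valued P \<pi>" and f: "embeds f G \<mu> P \<pi>"
    and j: "inj_on j (carrier P)" "j ` carrier P \<inter> carrier G = {}"
  obtains H :: "'g monoid" and \<nu> h where "valued H \<nu>" "embeds h P \<pi> H \<nu>" "h ` carrier P = carrier H"
    "carrier H \<subseteq> carrier G \<union> j ` carrier P" "\<And>x. x \<in> carrier G \<Longrightarrow> h (f x) = x"
    "embeds id G \<mu> H \<nu>"
proof -
  interpret f: group_hom G P f
    using embedsD(1)[OF f] valuedD(1)[OF G] valuedD(1)[OF P]
    by (simp add: group_hom_def group_hom_axioms_def)
  have injf: "inj_on f (carrier G)"
  proof (rule f.inj_on_one_iff[THEN iffD2], intro allI impI)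
    fix x assume x: "x \<in> carrier G" "f x = \<one>\<^bsub>P\<^esub>"
    have "\<mu> x = \<mu> \<one>\<^bsub>G\<^esub>"
      using embedsD(3)[OF f, of x] embedsD(3)[OF f, of "\<one>\<^bsub>G\<^esub>"] x by simp
    then show "x = \<one>\<^bsub>G\<^esub>" using valuedD(5)[OF G] valued_one[OF G] x by simp
  qed
  define h where "h p = (if p \<in> f ` carrier G then inv_into (carrier G) f p else j p)" for p
  have hf: "h (f x) = x" if "x \<in> carrier G" for x
    using that injf by (simp add: h_def)
  have h_in: "h p \<in> carrier G \<longleftrightarrow> p \<in> f ` carrier G" if "p \<in> carrier P" for p
    using that j(2) by (auto simp: h_def injf)
  have "inj_on h (carrier P)"
  proof (rule inj_onI)
    fix p q assume pq: "p \<in> carrier P" "q \<in> carrier P" "h p = h q"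
    show "p = q"
    proof (cases "p \<in> f ` carrier G")
      case True
      then have "q \<in> f ` carrier G" using h_in pq by metis
      then show ?thesis using True pq(3) hf by auto
    next
      case False
      then have "q \<notin> f ` carrier G" using h_in pq by metis
      then show ?thesis using False pq j(1) by (auto simp: h_def dest: inj_onD)
    qed
  qed
  then obtain H :: "'g monoid" and \<nu> where H: "valued H \<nu>" "carrier H = h ` carrier P" "embeds h P \<pi> H \<nu>"
    using valued_image[OF P] by blast
  show thesis
  proof (rule that[OF H(1,3) H(2)[symmetric] _ hf])
    show "carrier H \<subseteq> carrier G \<union> j ` carrier P"
      using H(2) by (auto simp: h_def injf)
    show "embeds id G \<mu> H \<nu>"
      by (rule embeds_cong[OF embeds_trans[OF f H(3)]]) (use hf valuedD(1)[OF G] in auto)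
  qed
qed

end

section \<open>Amalgams of finite valued groups\<close>

context distributive_algebraic_lattice
begin

text \<open>
  The coordinates of \<open>P\<close> are indexed by the thresholds \<open>d \<in> I\<close> for the finite set \<open>V\<close> of all occurring
  values; the \<open>d\<close>-th coordinate amalgamates the quotients of \<open>G1\<close> and \<open>G2\<close> by their elements of value
  \<open>\<sqsubseteq> d\<close>. An element \<open>x\<close> is trivial there iff its value is \<open>\<sqsubseteq> d\<close>, so the weights of its nontrivial
  coordinates join up to its value. For the separation property, suppose that \<open>x\<close> is nontrivial at \<open>d\<close>. Then
  so is some \<open>y \<in> Y\<close>, and the commutators of \<open>f1 y\<close> with elements supported at \<open>d\<close> lie in \<open>M\<close> and generate
  the \<open>d\<close>-th coordinate of \<open>f1 x\<close>.
\<close>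

lemma valued_amalgam:
  fixes G1 :: "('g, 'm) monoid_scheme" and G2 :: "('h, 'n) monoid_scheme"
  assumes v: "valued G \<mu>" "valued G1 \<mu>1" "valued G2 \<mu>2"
    and e1: "embeds e1 G \<mu> G1 \<mu>1" and e2: "embeds e2 G \<mu> G2 \<mu>2"
    and fin: "finite (carrier G1)" "finite (carrier G2)"
  obtains P :: "('a \<Rightarrow> ('g set \<times> 'h set) \<times> bool \<Rightarrow> ('g set \<times> 'h set) \<times> bool) monoid" and \<pi> f1 f2
  where "finite (carrier P)" "valued P \<pi>" "embeds f1 G1 \<mu>1 P \<pi>" "embeds f2 G2 \<mu>2 P \<pi>"
    "\<And>x. x \<in> carrier G \<Longrightarrow> f1 (e1 x) = f2 (e2 x)" "separates f1 G1 \<mu>1 P"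
proof -
  note v0 = valuedD[OF v(1)] and v1 = valuedD[OF v(2)] and v2 = valuedD[OF v(3)]
  have e1': "e1 \<in> hom G G1" "\<And>x. x \<in> carrier G \<Longrightarrow> \<mu>1 (e1 x) = \<mu> x"
    and e2': "e2 \<in> hom G G2" "\<And>x. x \<in> carrier G \<Longrightarrow> \<mu>2 (e2 x) = \<mu> x"
    using e1 e2 by (simp_all add: embeds_def)
  define V where "V = \<mu>1 ` carrier G1 \<union> \<mu>2 ` carrier G2"
  have V: "finite V" "V \<subseteq> compact_elements L" using fin v1(2) v2(2) by (auto simp: V_def)
  obtain I c where I: "finite I" "I \<subseteq> carrier L"
    and c: "\<And>d. d \<in> I \<Longrightarrow> c d \<in> compact_elements L \<and> c d \<noteq> \<Squnion>{}"
    and c_le: "\<And>v d. \<lbrakk>v \<in> V; d \<in> I; \<not> v \<sqsubseteq> d\<rbrakk> \<Longrightarrow> c d \<sqsubseteq> v"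
    and le_c: "\<And>v. v \<in> V \<Longrightarrow> v \<sqsubseteq> \<Squnion>(c ` {d \<in> I. \<not> v \<sqsubseteq> d})"
    by (rule finite_compact_decomposition[OF V]) (rule that; assumption)
  have cL: "c ` A \<subseteq> carrier L" if "A \<subseteq> I" for A using c compact_carrier that by blast
  have V_eq: "v = \<Squnion>(c ` {d \<in> I. \<not> v \<sqsubseteq> d})" if "v \<in> V" for v
  proof (rule le_antisym[OF le_c[OF that]])
    show vL: "v \<in> carrier L" using that V compact_carrier by blast
    show "\<Squnion>(c ` {d \<in> I. \<not> v \<sqsubseteq> d}) \<sqsubseteq> v"
      by (rule sup_least[OF _ vL]) (use cL c_le that in auto)
    show "\<Squnion>(c ` {d \<in> I. \<not> v \<sqsubseteq> d}) \<in> carrier L" by (rule sup_closed) (use cL in auto)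
  qed
  define N1 where "N1 d = {x \<in> carrier G1. \<mu>1 x \<sqsubseteq> d}" for d
  define N2 where "N2 d = {x \<in> carrier G2. \<mu>2 x \<sqsubseteq> d}" for d
  define am where "am d Z k1 k2 \<longleftrightarrow> finite Z \<and> k1 \<in> hom G1 (perm_group Z) \<and> k2 \<in> hom G2 (perm_group Z) \<and>
    (\<forall>g\<in>carrier G. k1 (e1 g) = k2 (e2 g)) \<and>
    (\<forall>x\<in>carrier G1. k1 x = id \<longleftrightarrow> x \<in> N1 d) \<and> (\<forall>x\<in>carrier G2. k2 x = id \<longleftrightarrow> x \<in> N2 d) \<and>
    (\<forall>M a b. M \<lhd> perm_group Z \<longrightarrow> a \<in> carrier G1 \<longrightarrow> b \<in> carrier G1 \<longrightarrow> a \<notin> N1 d \<longrightarrow>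
      (\<forall>s. s permutes Z \<longrightarrow> k1 a \<circ> s \<circ> inv_into UNIV (k1 a) \<circ> inv_into UNIV s \<in> M) \<longrightarrow> k1 b \<in> M)"
    for d and Z :: "(('g set \<times> 'h set) \<times> bool) set" and k1 k2
  have "\<exists>Z k1 k2. am d Z k1 k2" if d: "d \<in> I" for d
  proof -
    have dL: "d \<in> carrier L" using d I by blast
    have N: "N1 d \<lhd> G1" "N2 d \<lhd> G2" unfolding N1_def N2_def using v1(4)[OF dL] v2(4)[OF dL] .
    have ker: "e1 g \<in> N1 d \<longleftrightarrow> e2 g \<in> N2 d" if "g \<in> carrier G" for g
      using that e1' e2' hom_in_carrier[OF e1'(1) that] hom_in_carrier[OF e2'(1) that]
      by (simp add: N1_def N2_def)
    show ?thesis
      by (rule amalgam_mod_normal_subgroups[OF v0(1) v1(1) v2(1) e1'(1) e2'(1) N ker fin])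
        (assumption, unfold am_def, blast)
  qed
  then obtain Z k1 k2 where am: "\<And>d. d \<in> I \<Longrightarrow> am d (Z d) (k1 d) (k2 d)" by metis
  have Z: "finite (Z d)" and k1: "k1 d \<in> hom G1 (perm_group (Z d))"
    and k2: "k2 d \<in> hom G2 (perm_group (Z d))"
    and agree: "\<And>g. g \<in> carrier G \<Longrightarrow> k1 d (e1 g) = k2 d (e2 g)"
    and ker1: "\<And>x. x \<in> carrier G1 \<Longrightarrow> k1 d x = id \<longleftrightarrow> x \<in> N1 d"
    and ker2: "\<And>x. x \<in> carrier G2 \<Longrightarrow> k2 d x = id \<longleftrightarrow> x \<in> N2 d"
    and sep: "\<And>M a b. \<lbrakk>M \<lhd> perm_group (Z d); a \<in> carrier G1; b \<in> carrier G1; a \<notin> N1 d;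
      \<And>s. s permutes (Z d) \<Longrightarrow> k1 d a \<circ> s \<circ> inv_into UNIV (k1 d a) \<circ> inv_into UNIV s \<in> M\<rbrakk>
      \<Longrightarrow> k1 d b \<in> M"
    if "d \<in> I" for d
    using am[OF that] unfolding am_def by blast+
  define S where "S d = perm_group (Z d)" for d
  have S: "group (S d)" for d by (simp add: S_def)
  define P where "P = product_group I S"
  define \<pi> where "\<pi> p = \<Squnion>(c ` {i \<in> I. p i \<noteq> \<one>\<^bsub>S i\<^esub>})" for p
  define f1 where "f1 x = (\<lambda>d\<in>I. k1 d x)" for x
  define f2 where "f2 x = (\<lambda>d\<in>I. k2 d x)" for x
  have P: "group P" unfolding P_def using S by simp
  interpret P: group P by (rule P)
  interpret G1: group G1 by (rule v1)
  have finP: "finite (carrier P)"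
    unfolding P_def using I Z by (auto intro!: finite_PiE finite_perm_group simp: S_def)
  have vP: "valued P \<pi>" unfolding P_def \<pi>_def using I S c by (intro valued_product)
  have hom1: "f1 \<in> hom G1 P"
    using k1 unfolding P_def S_def f1_def by (auto simp: hom_def PiE_def fun_eq_iff)
  have hom2: "f2 \<in> hom G2 P"
    using k2 unfolding P_def S_def f2_def by (auto simp: hom_def PiE_def fun_eq_iff)
  have \<pi>1: "\<pi> (f1 x) = \<mu>1 x" if x: "x \<in> carrier G1" for x
  proof -
    have "{i \<in> I. f1 x i \<noteq> \<one>\<^bsub>S i\<^esub>} = {d \<in> I. \<not> \<mu>1 x \<sqsubseteq> d}"
      using x ker1 by (auto simp: f1_def S_def N1_def)
    then show ?thesis using V_eq[of "\<mu>1 x"] x by (simp add: \<pi>_def V_def)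
  qed
  have \<pi>2: "\<pi> (f2 x) = \<mu>2 x" if x: "x \<in> carrier G2" for x
  proof -
    have "{i \<in> I. f2 x i \<noteq> \<one>\<^bsub>S i\<^esub>} = {d \<in> I. \<not> \<mu>2 x \<sqsubseteq> d}"
      using x ker2 by (auto simp: f2_def S_def N2_def)
    then show ?thesis using V_eq[of "\<mu>2 x"] x by (simp add: \<pi>_def V_def)
  qed
  have agree12: "f1 (e1 x) = f2 (e2 x)" if "x \<in> carrier G" for x
    using agree that by (auto simp: f1_def f2_def)
  have sepP: "separates f1 G1 \<mu>1 P"
    unfolding separates_def
  proof (intro allI impI)
    fix M Y x
    assume M: "M \<lhd> P" and Y: "finite Y" "Y \<subseteq> carrier G1" and x: "x \<in> carrier G1"
      and fY: "f1 ` Y \<subseteq> M" and le: "\<mu>1 x \<sqsubseteq> \<Squnion>(\<mu>1 ` Y)"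
    interpret M: normal M P by (rule M)
    note sM = M.subgroup_axioms
    have \<mu>Y: "\<mu>1 ` Y \<subseteq> carrier L" using Y v1(3) by blast
    show "f1 x \<in> M"
    proof (rule product_in_subgroup_of_singles[OF S I(1)])
      show "subgroup M (product_group I S)" using sM by (simp add: P_def)
      show "f1 x \<in> carrier (product_group I S)" using hom_in_carrier[OF hom1 x] by (simp add: P_def)
      fix d assume d: "d \<in> I"
      then have dL: "d \<in> carrier L" using I by blast
      have f1xd: "f1 x d = k1 d x" using d by (simp add: f1_def)
      have sh: "single I S d \<in> hom (S d) P"
        unfolding P_def using S d by (intro single_hom)
      interpret sh: group_hom "S d" P "single I S d"
        using sh S P by (simp add: group_hom_def group_hom_axioms_def)
      show "single I S d (f1 x d) \<in> M"
      proof (cases "x \<in> N1 d")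
        case True
        then have "f1 x d = \<one>\<^bsub>S d\<^esub>" using ker1[OF d x] f1xd by (simp add: S_def)
        then show ?thesis using sh.hom_one subgroup.one_closed[OF sM] by simp
      next
        case False
        have "\<exists>y\<in>Y. y \<notin> N1 d"
        proof (rule ccontr)
          assume "\<not> (\<exists>y\<in>Y. y \<notin> N1 d)"
          then have "\<Squnion>(\<mu>1 ` Y) \<sqsubseteq> d"
            by (intro sup_least[OF \<mu>Y dL]) (auto simp: N1_def)
          then have "\<mu>1 x \<sqsubseteq> d"
            by (rule le_trans[OF le]) (use dL \<mu>Y v1(3)[OF x] in auto)
          then show False using False x by (simp add: N1_def)
        qed
        then obtain y where y: "y \<in> Y" "y \<notin> N1 d" by blast
        have yG: "y \<in> carrier G1" using y Y by blast
        define Md where "Md = {s \<in> carrier (S d). single I S d s \<in> M}"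
        have "Md \<lhd> S d" unfolding Md_def using S P sh M by (intro normal_preimage)
        moreover have "k1 d y \<circ> s \<circ> inv_into UNIV (k1 d y) \<circ> inv_into UNIV s \<in> Md"
          if s: "s permutes Z d" for s
        proof -
          let ?t = "single I S d s"
          have sS: "s \<in> carrier (S d)" using s by (simp add: S_def)
          have tP: "?t \<in> carrier P" using sS by simp
          have ky: "k1 d y \<in> carrier (S d)" using hom_in_carrier[OF k1[OF d] yG] by (simp add: S_def)
          have fy: "f1 y \<in> M" "f1 y \<in> carrier P" using fY y hom_in_carrier[OF hom1 yG] by auto
          have eq: "k1 d y \<circ> s \<circ> inv_into UNIV (k1 d y) \<circ> inv_into UNIV s =
            k1 d y \<otimes>\<^bsub>S d\<^esub> s \<otimes>\<^bsub>S d\<^esub> inv\<^bsub>S d\<^esub> (k1 d y) \<otimes>\<^bsub>S d\<^esub> inv\<^bsub>S d\<^esub> s" (is "?l = ?r")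
            using s ky by (simp add: S_def)
          have "?t \<otimes>\<^bsub>P\<^esub> inv\<^bsub>P\<^esub> (f1 y) \<otimes>\<^bsub>P\<^esub> inv\<^bsub>P\<^esub> ?t \<in> M"
            using M.inv_op_closed2[OF tP] subgroup.m_inv_closed[OF sM fy(1)] by blast
          then have "f1 y \<otimes>\<^bsub>P\<^esub> (?t \<otimes>\<^bsub>P\<^esub> inv\<^bsub>P\<^esub> (f1 y) \<otimes>\<^bsub>P\<^esub> inv\<^bsub>P\<^esub> ?t) \<in> M"
            by (rule subgroup.m_closed[OF sM fy(1)])
          also have "f1 y \<otimes>\<^bsub>P\<^esub> (?t \<otimes>\<^bsub>P\<^esub> inv\<^bsub>P\<^esub> (f1 y) \<otimes>\<^bsub>P\<^esub> inv\<^bsub>P\<^esub> ?t) = single I S d ?r"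
          proof
            fix i
            have invP: "inv\<^bsub>P\<^esub> p = (\<lambda>i\<in>I. inv\<^bsub>S i\<^esub> p i)" if "p \<in> carrier P" for p
              using that S unfolding P_def by (intro inv_product_group) auto
            have fyi: "i \<in> I \<Longrightarrow> f1 y i \<in> carrier (S i)" using fy by (auto simp: P_def)
            interpret Si: group "S i" by (rule S)
            show "(f1 y \<otimes>\<^bsub>P\<^esub> (?t \<otimes>\<^bsub>P\<^esub> inv\<^bsub>P\<^esub> (f1 y) \<otimes>\<^bsub>P\<^esub> inv\<^bsub>P\<^esub> ?t)) i = single I S d ?r i"
              unfolding invP[OF fy(2)] invP[OF tP]
            proof (cases "i \<in> I")
              case True
              then show "(f1 y \<otimes>\<^bsub>P\<^esub> (?t \<otimes>\<^bsub>P\<^esub> (\<lambda>i\<in>I. inv\<^bsub>S i\<^esub> f1 y i) \<otimes>\<^bsub>P\<^esub> (\<lambda>i\<in>I. inv\<^bsub>S i\<^esub> ?t i))) i =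
                single I S d ?r i"
                using fyi sS ky by (cases "i = d") (auto simp: P_def single_def f1_def sh.G.m_assoc)
            qed (simp add: P_def single_def)
          qed
          finally show ?thesis using eq sS ky unfolding Md_def by simp
        qed
        ultimately have "k1 d x \<in> Md" using sep[OF d _ yG x y(2)] unfolding S_def by blast
        then show ?thesis using f1xd by (simp add: Md_def)
      qed
    qed
  qed
  show thesis
  proof (rule that[OF finP vP _ _ agree12 sepP])
    show "embeds f1 G1 \<mu>1 P \<pi>" unfolding embeds_def using hom1 \<pi>1 by blast
    show "embeds f2 G2 \<mu>2 P \<pi>" unfolding embeds_def using hom2 \<pi>2 by blast
  qed
qed

end

section \<open>Unions of chains of valued groups\<close>

lemma locally_finite_surj_image:
  assumes G: "locally_finite_group G" and H: "group H" and h: "h \<in> hom G H"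
    and surj: "h ` carrier G = carrier H"
  shows "locally_finite_group H"
proof -
  interpret G: locally_finite_group G by (rule G)
  interpret h: group_hom G H h using H h by (simp add: group_hom_def group_hom_axioms_def)
  show ?thesis
  proof unfold_locales
    fix A assume A: "A \<subseteq> carrier H" "finite A"
    then obtain B where B: "B \<subseteq> carrier G" "finite B" "A = h ` B"
      using finite_subset_image[of A h "carrier G"] surj by auto
    then show "finite (generate H A)"
      using h.generate_img[OF B(1)] G.finite_generate by simp
  qed
qed

context distributive_algebraic_lattice
begin

lemma chain_finite_subset:
  assumes "I \<noteq> {}" "\<And>i j. \<lbrakk>i \<in> I; j \<in> I\<rbrakk> \<Longrightarrow> C i \<subseteq> C j \<or> C j \<subseteq> C i"
    and "finite F" "F \<subseteq> (\<Union>i\<in>I. C i)"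
  shows "\<exists>i\<in>I. F \<subseteq> C i"
  using assms(3,4)
proof (induction F)
  case empty
  then show ?case using assms(1) by blast
next
  case (insert x F)
  then obtain i j where "i \<in> I" "j \<in> I" "F \<subseteq> C i" "x \<in> C j" by blast
  then show ?case using assms(2)[of i j] by blast
qed

text \<open>
  Finitely many elements of the union lie in a common member of the chain, where all the laws can be
  checked.
\<close>

lemma valued_chain_union:
  fixes S :: "'i \<Rightarrow> 'g monoid"
  assumes I: "I \<noteq> {}" and v: "\<And>i. i \<in> I \<Longrightarrow> valued (S i) (\<mu> i)"
    and chain: "\<And>i j. \<lbrakk>i \<in> I; j \<in> I\<rbrakk> \<Longrightarrow>
      embeds id (S i) (\<mu> i) (S j) (\<mu> j) \<or> embeds id (S j) (\<mu> j) (S i) (\<mu> i)"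
  obtains U :: "'g monoid" and \<upsilon> where "valued U \<upsilon>" "carrier U = (\<Union>i\<in>I. carrier (S i))"
    "\<And>i. i \<in> I \<Longrightarrow> embeds id (S i) (\<mu> i) U \<upsilon>"
proof -
  let ?C = "\<Union>i\<in>I. carrier (S i)"
  have sub: "carrier (S i) \<subseteq> carrier (S j) \<or> carrier (S j) \<subseteq> carrier (S i)" if "i \<in> I" "j \<in> I" for i j
    using chain[OF that] embeds_id_subset by blast
  have common: "\<exists>i\<in>I. F \<subseteq> carrier (S i)" if "finite F" "F \<subseteq> ?C" for F
    using chain_finite_subset[OF I sub that] by blast
  define k where "k F = (SOME i. i \<in> I \<and> F \<subseteq> carrier (S i))" for F
  have k: "k F \<in> I \<and> F \<subseteq> carrier (S (k F))" if "finite F" "F \<subseteq> ?C" for F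
    unfolding k_def by (rule someI_ex) (use common[OF that] in blast)
  define U where "U = \<lparr>carrier = ?C, monoid.mult = (\<lambda>x y. x \<otimes>\<^bsub>S (k {x, y})\<^esub> y), one = \<one>\<^bsub>S (k {})\<^esub>\<rparr>"
  define \<upsilon> where "\<upsilon> x = \<mu> (k {x}) x" for x
  have cU: "carrier U = ?C" by (simp add: U_def)
  have grp: "group (S i)" if "i \<in> I" for i using valuedD(1)[OF v[OF that]] .
  have mult_agree: "x \<otimes>\<^bsub>S i\<^esub> y = x \<otimes>\<^bsub>S j\<^esub> y"
    if "i \<in> I" "j \<in> I" "x \<in> carrier (S i)" "y \<in> carrier (S i)" "x \<in> carrier (S j)" "y \<in> carrier (S j)" for i j x y
    using chain[OF that(1,2)] embedsD(4)[where f = id] that(3-) by fastforce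
  have mU: "x \<otimes>\<^bsub>U\<^esub> y = x \<otimes>\<^bsub>S i\<^esub> y" if "i \<in> I" "x \<in> carrier (S i)" "y \<in> carrier (S i)" for i x y
    using mult_agree[OF _ that(1), of "k {x, y}"] k[of "{x, y}"] that by (auto simp: U_def)
  have oU: "\<one>\<^bsub>U\<^esub> = \<one>\<^bsub>S i\<^esub>" if i: "i \<in> I" for i
  proof -
    have k0: "k {} \<in> I" using k[of "{}"] by simp
    have one_eq: "\<one>\<^bsub>S j\<^esub> = \<one>\<^bsub>S i\<^esub>" if "i \<in> I" "j \<in> I" "embeds id (S i) (\<mu> i) (S j) (\<mu> j)" for i j
    proof -
      interpret group_hom "S i" "S j" id
        using grp that embedsD(1)[OF that(3)] by (simp add: group_hom_def group_hom_axioms_def)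
      show ?thesis using hom_one by simp
    qed
    show ?thesis using chain[OF k0 i] one_eq[OF k0 i] one_eq[OF i k0] by (auto simp: U_def)
  qed
  have vU: "\<upsilon> x = \<mu> i x" if "i \<in> I" "x \<in> carrier (S i)" for i x
  proof -
    have k1: "k {x} \<in> I" "x \<in> carrier (S (k {x}))" using k[of "{x}"] that by auto
    show ?thesis
      using chain[OF k1(1) that(1)] embedsD(3)[where f = id] k1(2) that(2) unfolding \<upsilon>_def by fastforce
  qed
  have common1: "\<exists>i\<in>I. x \<in> carrier (S i)" if "x \<in> carrier U" for x using that by (simp add: cU)
  have common3: "\<exists>i\<in>I. x \<in> carrier (S i) \<and> y \<in> carrier (S i) \<and> z \<in> carrier (S i)"
    if "x \<in> carrier U" "y \<in> carrier U" "z \<in> carrier U" for x y z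
    using common[of "{x, y, z}"] that by (auto simp: cU)
  have subU: "carrier (S i) \<subseteq> carrier U" if "i \<in> I" for i using that by (auto simp: cU)
  have U: "group U"
  proof (rule groupI)
    fix x y z assume xyz: "x \<in> carrier U" "y \<in> carrier U" "z \<in> carrier U"
    then obtain i where i: "i \<in> I" "x \<in> carrier (S i)" "y \<in> carrier (S i)" "z \<in> carrier (S i)"
      using common3 by blast
    interpret Si: group "S i" by (rule grp[OF i(1)])
    show "x \<otimes>\<^bsub>U\<^esub> y \<otimes>\<^bsub>U\<^esub> z = x \<otimes>\<^bsub>U\<^esub> (y \<otimes>\<^bsub>U\<^esub> z)"
      using i mU[OF i(1)] by (simp add: Si.m_assoc)
  next
    fix x y assume xy: "x \<in> carrier U" "y \<in> carrier U"
    then obtain i where i: "i \<in> I" "x \<in> carrier (S i)" "y \<in> carrier (S i)"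
      using common3 by blast
    interpret Si: group "S i" by (rule grp[OF i(1)])
    show "x \<otimes>\<^bsub>U\<^esub> y \<in> carrier U" using i mU[OF i] subU by auto
  next
    obtain i where i: "i \<in> I" using I by blast
    interpret Si: group "S i" by (rule grp[OF i(1)])
    show "\<one>\<^bsub>U\<^esub> \<in> carrier U" using oU[OF i] subU[OF i] by auto
  next
    fix x assume "x \<in> carrier U"
    then obtain i where i: "i \<in> I" "x \<in> carrier (S i)" using common1 by blast
    interpret Si: group "S i" by (rule grp[OF i(1)])
    show "\<one>\<^bsub>U\<^esub> \<otimes>\<^bsub>U\<^esub> x = x" using i mU[OF i(1)] oU[OF i(1)] by simp
    show "\<exists>y\<in>carrier U. y \<otimes>\<^bsub>U\<^esub> x = \<one>\<^bsub>U\<^esub>"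
      using i mU[OF i(1)] oU[OF i(1)] subU[OF i(1)] by (intro bexI[of _ "inv\<^bsub>S i\<^esub> x"]) auto
  qed
  have emb: "embeds id (S i) (\<mu> i) U \<upsilon>" if "i \<in> I" for i
    using that subU[OF that] mU[OF that] vU[OF that] by (auto simp: embeds_def hom_def)
  interpret U: group U by (rule U)
  have "valued U \<upsilon>"
    unfolding valued_def
  proof (intro conjI ballI impI)
    fix x assume "x \<in> carrier U"
    then obtain i where i: "i \<in> I" "x \<in> carrier (S i)" using common1 by blast
    show "\<upsilon> x \<in> compact_elements L" using vU[OF i] valuedD(2)[OF v[OF i(1)] i(2)] by simp
    show "x = \<one>\<^bsub>U\<^esub>" if "\<upsilon> x = \<Squnion>{}"
      using that vU[OF i] valuedD(5)[OF v[OF i(1)] i(2)] oU[OF i(1)] by simp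
  next
    fix d assume d: "d \<in> carrier L"
    let ?N = "{x \<in> carrier U. \<upsilon> x \<sqsubseteq> d}"
    have N: "{x \<in> carrier (S i). \<mu> i x \<sqsubseteq> d} \<lhd> S i" if "i \<in> I" for i using valuedD(4)[OF v[OF that] d] .
    have mem: "x \<in> ?N \<longleftrightarrow> x \<in> {x \<in> carrier (S i). \<mu> i x \<sqsubseteq> d}" if "i \<in> I" "x \<in> carrier (S i)" for i x
      using that vU[OF that] subU[OF that(1)] by auto
    have invU: "inv\<^bsub>U\<^esub> x = inv\<^bsub>S i\<^esub> x" if "i \<in> I" "x \<in> carrier (S i)" for i x
    proof -
      interpret group_hom "S i" U id
        using grp[OF that(1)] U embedsD(1)[OF emb[OF that(1)]] by (simp add: group_hom_def group_hom_axioms_def)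
      show ?thesis using hom_inv[OF that(2)] by simp
    qed
    have "subgroup ?N U"
    proof (rule U.subgroupI)
      show "?N \<subseteq> carrier U" by blast
      obtain i where i: "i \<in> I" using I by blast
      interpret Ni: normal "{x \<in> carrier (S i). \<mu> i x \<sqsubseteq> d}" "S i" by (rule N[OF i])
      have "\<one>\<^bsub>S i\<^esub> \<in> ?N" using mem[OF i Ni.is_group[THEN group.is_monoid, THEN monoid.one_closed]]
          subgroup.one_closed[OF Ni.subgroup_axioms] by (rule iffD2)
      then show "?N \<noteq> {}" by blast
    next
      fix x assume x: "x \<in> ?N"
      then obtain i where i: "i \<in> I" "x \<in> carrier (S i)" using common1 by blast
      interpret Ni: normal "{x \<in> carrier (S i). \<mu> i x \<sqsubseteq> d}" "S i" by (rule N[OF i(1)])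
      show "inv\<^bsub>U\<^esub> x \<in> ?N"
        unfolding invU[OF i] mem[OF i(1) Ni.inv_closed[OF i(2)]]
        by (rule subgroup.m_inv_closed[OF Ni.subgroup_axioms x[unfolded mem[OF i]]])
      fix y assume y: "y \<in> ?N"
      then obtain j where j: "j \<in> I" "x \<in> carrier (S j)" "y \<in> carrier (S j)"
        using common3[of x y y] x by blast
      interpret Nj: normal "{x \<in> carrier (S j). \<mu> j x \<sqsubseteq> d}" "S j" by (rule N[OF j(1)])
      have "x \<otimes>\<^bsub>S j\<^esub> y \<in> carrier (S j)"
        using monoid.m_closed[OF group.is_monoid[OF grp[OF j(1)]] j(2,3)] .
      then show "x \<otimes>\<^bsub>U\<^esub> y \<in> ?N"
        unfolding mU[OF j] mem[OF j(1) \<open>x \<otimes>\<^bsub>S j\<^esub> y \<in> carrier (S j)\<close>]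
        by (intro subgroup.m_closed[OF Nj.subgroup_axioms x[unfolded mem[OF j(1,2)]] y[unfolded mem[OF j(1,3)]]])
    qed
    moreover have "g \<otimes>\<^bsub>U\<^esub> x \<otimes>\<^bsub>U\<^esub> inv\<^bsub>U\<^esub> g \<in> ?N" if g: "g \<in> carrier U" and x: "x \<in> ?N" for g x
    proof -
      obtain i where i: "i \<in> I" "g \<in> carrier (S i)" "x \<in> carrier (S i)"
        using common3[of g x x] g x by blast
      interpret Si: group "S i" by (rule grp[OF i(1)])
      have gx: "g \<otimes>\<^bsub>S i\<^esub> x \<in> carrier (S i)" "inv\<^bsub>S i\<^esub> g \<in> carrier (S i)"
        using Si.m_closed[OF i(2,3)] Si.inv_closed[OF i(2)] .
      have eq: "g \<otimes>\<^bsub>U\<^esub> x \<otimes>\<^bsub>U\<^esub> inv\<^bsub>U\<^esub> g = g \<otimes>\<^bsub>S i\<^esub> x \<otimes>\<^bsub>S i\<^esub> inv\<^bsub>S i\<^esub> g"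
        unfolding invU[OF i(1,2)] mU[OF i] mU[OF i(1) gx] ..
      show ?thesis
        unfolding eq mem[OF i(1) Si.m_closed[OF gx]]
        by (rule normal.inv_op_closed2[OF N[OF i(1)] i(2) x[unfolded mem[OF i(1,3)]]])
    qed
    ultimately show "?N \<lhd> U" unfolding U.normal_inv_iff by blast
  qed (rule U)
  then show thesis using cU emb by (rule that)
qed


text \<open>
  A relation \<open>\<mu> x \<sqsubseteq> \<Squnion>(\<mu> ` Y)\<close> involves finitely many elements, so it holds in one \<open>S i\<close> and is resolved in
  some later \<open>S j\<close>.
\<close>

lemma separates_id_union:
  assumes U: "valued U \<upsilon>" "carrier U = (\<Union>i\<in>I. carrier (S i))"
    and S: "\<And>i. i \<in> I \<Longrightarrow> valued (S i) (\<mu> i)"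
    and emb: "\<And>i. i \<in> I \<Longrightarrow> embeds id (S i) (\<mu> i) U \<upsilon>"
    and I: "I \<noteq> {}"
    and chain: "\<And>i j. \<lbrakk>i \<in> I; j \<in> I\<rbrakk> \<Longrightarrow> carrier (S i) \<subseteq> carrier (S j) \<or> carrier (S j) \<subseteq> carrier (S i)"
    and sep: "\<And>i. i \<in> I \<Longrightarrow> \<exists>j\<in>I. carrier (S i) \<subseteq> carrier (S j) \<and> separates id (S i) (\<mu> i) (S j)"
  shows "separates id U \<upsilon> U"
  unfolding separates_def
proof (intro allI impI)
  fix M Y x assume *: "M \<lhd> U" "finite Y" "Y \<subseteq> carrier U" "x \<in> carrier U" "id ` Y \<subseteq> M" "\<upsilon> x \<sqsubseteq> \<Squnion>(\<upsilon> ` Y)"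
  obtain i where i: "i \<in> I" "insert x Y \<subseteq> carrier (S i)"
    using chain_finite_subset[where C = "\<lambda>i. carrier (S i)" and F = "insert x Y", OF I chain] *(2,3,4) U(2) by auto
  obtain j where j: "j \<in> I" "carrier (S i) \<subseteq> carrier (S j)" "separates id (S i) (\<mu> i) (S j)"
    using sep[OF i(1)] by blast
  have "separates (id \<circ> id) (S i) (\<mu> i) U"
    using j valuedD(1)[OF S[OF j(1)]] valuedD(1)[OF U(1)] embedsD(1)[OF emb[OF j(1)]]
    by (intro separates_comp[OF _ j(3)]) auto
  moreover have "\<upsilon> ` Y = \<mu> i ` Y"
    using embedsD(3)[OF emb[OF i(1)]] i(2) by (intro image_cong) auto
  moreover have "\<upsilon> x = \<mu> i x" using embedsD(3)[OF emb[OF i(1)], of x] i(2) by simp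
  ultimately show "id x \<in> M"
    using * i(2) unfolding separates_def by simp
qed

lemma locally_finite_union:
  assumes U: "valued U \<upsilon>" "carrier U = (\<Union>i\<in>I. carrier (S i))"
    and S: "\<And>i. i \<in> I \<Longrightarrow> locally_finite_group (S i)"
    and emb: "\<And>i. i \<in> I \<Longrightarrow> embeds id (S i) (\<mu> i) U \<upsilon>"
    and I: "I \<noteq> {}"
    and chain: "\<And>i j. \<lbrakk>i \<in> I; j \<in> I\<rbrakk> \<Longrightarrow> carrier (S i) \<subseteq> carrier (S j) \<or> carrier (S j) \<subseteq> carrier (S i)"
  shows "locally_finite_group U"
proof -
  interpret U: group U by (rule valuedD(1)[OF U(1)])
  show ?thesis
  proof unfold_locales
    fix A assume A: "A \<subseteq> carrier U" "finite A"
    obtain i where i: "i \<in> I" "A \<subseteq> carrier (S i)"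
      using chain_finite_subset[where C = "\<lambda>i. carrier (S i)" and F = A, OF I chain] A U(2) by auto
    interpret Si: locally_finite_group "S i" by (rule S[OF i(1)])
    interpret h: group_hom "S i" U id
      using embedsD(1)[OF emb[OF i(1)]] by (simp add: group_hom_def group_hom_axioms_def)
    show "finite (generate U A)"
      using h.generate_img[OF i(2)] Si.finite_generate[OF i(2) A(2)] by simp
  qed
qed

end

section \<open>Countable self-separating extensions\<close>

context distributive_algebraic_lattice
begin

lemma finite_valued_group_with_value:
  assumes d: "d \<in> compact_elements L"
  obtains H :: "nat monoid" and \<nu> where "finite (carrier H)" "valued H \<nu>" "\<exists>z\<in>carrier H. \<nu> z = d"
proof -
  \<comment> \<open>If \<open>d\<close> is the least element, the identity has the value \<open>d\<close> and a factor of weight \<open>d\<close> would not be admissible.\<close>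
  define I where "I = (if d = \<Squnion>{} then {} else {()})"
  define S where "S = (\<lambda>_ :: unit. perm_group (UNIV :: bool set))"
  let ?P = "product_group I S" and ?\<pi> = "\<lambda>p. \<Squnion>((\<lambda>_. d) ` {i \<in> I. p i \<noteq> \<one>\<^bsub>S i\<^esub>})"
  have fin: "finite (carrier ?P)" by (rule finite)
  have v: "valued ?P ?\<pi>"
    using d by (intro valued_product) (auto simp: I_def S_def split: if_splits)
  have z: "\<exists>z\<in>carrier ?P. ?\<pi> z = d"
  proof (cases "d = \<Squnion>{}")
    case True
    have "\<one>\<^bsub>?P\<^esub> \<in> carrier ?P"
      using valuedD(1)[OF v] by (simp only: group.is_monoid monoid.one_closed)
    then show ?thesis using True valued_one[OF v] by blast
  next
    case False
    \<comment> \<open>Negation is the nontrivial element of a group of order two.\<close>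
    define z where "z = (\<lambda>i\<in>I. Not)"
    have "Not permutes UNIV" by (rule bij_imp_permutes) (auto simp: bij_betw_def inj_on_def)
    then have "z \<in> carrier ?P" by (auto simp: z_def S_def)
    moreover have "{i \<in> I. z i \<noteq> \<one>\<^bsub>S i\<^esub>} = {()}"
      using False by (auto simp: z_def S_def I_def fun_eq_iff)
    then have "?\<pi> z = d" using d compact_carrier by simp
    ultimately show ?thesis by blast
  qed
  have "inj_on (to_nat :: (unit \<Rightarrow> bool \<Rightarrow> bool) \<Rightarrow> nat) (carrier ?P)" by simp
  then obtain H :: "nat monoid" and \<nu> where H: "valued H \<nu>" "carrier H = to_nat ` carrier ?P"
    "embeds to_nat ?P ?\<pi> H \<nu>"
    by (rule valued_image[OF v])
  show thesis
  proof (rule that[OF _ H(1)])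
    show "finite (carrier H)" using H(2) fin by simp
    show "\<exists>z\<in>carrier H. \<nu> z = d" using z H(2) embedsD(3)[OF H(3)] by auto
  qed
qed

lemma valued_subgroup:
  assumes A: "valued A \<mu>" and B: "subgroup B A"
  shows "valued (A\<lparr>carrier := B\<rparr>) \<mu>" "embeds id (A\<lparr>carrier := B\<rparr>) \<mu> A \<mu>"
proof -
  interpret group A by (rule valuedD(1)[OF A])
  have "id \<in> hom (A\<lparr>carrier := B\<rparr>) A" using subgroup.subset[OF B] by (auto simp: hom_def)
  then show "embeds id (A\<lparr>carrier := B\<rparr>) \<mu> A \<mu>" by (simp add: embeds_def)
  have "valued (A\<lparr>carrier := B\<rparr>) (\<lambda>x. \<mu> (id x))"
    using \<open>id \<in> hom (A\<lparr>carrier := B\<rparr>) A\<close> subgroup_imp_group[OF B] by (intro valued_pullback[OF A, of _ id]) auto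
  then show "valued (A\<lparr>carrier := B\<rparr>) \<mu>" by simp
qed

text \<open>
  Write \<open>A\<close> as the union of finite subgroups \<open>B 0 \<subseteq> B 1 \<subseteq> \<dots>\<close> and build finite groups
  \<open>S 0 \<subseteq> S 1 \<subseteq> \<dots>\<close> with embeddings \<open>f n\<close> of \<open>B n\<close> into \<open>S n\<close>: the group \<open>S (n + 1)\<close> is an amalgam of
  \<open>S n\<close> and \<open>B (n + 1)\<close> over \<open>B n\<close> that separates \<open>S n\<close>. The required value \<open>d\<close> is already put into \<open>S 0\<close>.
\<close>

lemma countable_extension:
  fixes A :: "'g monoid"
  assumes A: "valued A \<mu>" and lf: "locally_finite_group A" and cnt: "countable (carrier A)"
    and d: "d \<in> compact_elements L"
  obtains H :: "nat monoid" and \<nu> f where "valued H \<nu>" "locally_finite_group H" "embeds f A \<mu> H \<nu>"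
    "separates id H \<nu> H" "\<exists>z\<in>carrier H. \<nu> z = d"
proof -
  interpret A: locally_finite_group A by (rule lf)
  define a where "a = from_nat_into (carrier A)"
  have a: "range a = carrier A"
    unfolding a_def using cnt A.one_closed by (intro range_from_nat_into) auto
  define B where "B n = generate A (a ` {..<n})" for n
  define G where "G n = A\<lparr>carrier := B n\<rparr>" for n
  have cG [simp]: "carrier (G n) = B n" for n by (simp add: G_def)
  have aA: "a ` {..<n} \<subseteq> carrier A" for n using a by blast
  have B: "subgroup (B n) A" for n unfolding B_def using aA by (intro A.generate_is_subgroup)
  have finB: "finite (B n)" for n unfolding B_def using aA by (intro A.finite_generate) auto
  have mono: "B n \<subseteq> B m" if "n \<le> m" for n m
    unfolding B_def using that by (intro A.mono_generate image_mono) auto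
  have BA: "B n \<subseteq> carrier A" for n using subgroup.subset[OF B] .
  have UB: "\<exists>n. x \<in> B n" if x: "x \<in> carrier A" for x
  proof -
    obtain n where "x = a n" using x unfolding a[symmetric] by (rule rangeE)
    then have "x \<in> B (Suc n)" unfolding B_def by (intro generate.incl) auto
    then show ?thesis by (rule exI)
  qed
  have G: "valued (G n) \<mu>" for n unfolding G_def using valued_subgroup(1)[OF A B] .
  have GSuc: "embeds id (G n) \<mu> (G (Suc n)) \<mu>" for n
    using mono[of n "Suc n"] by (auto simp: embeds_def hom_def G_def)
  define P where "P n = (\<lambda>(H :: nat monoid, \<nu>, f). finite (carrier H) \<and> valued H \<nu> \<and> embeds f (G n) \<mu> H \<nu> \<and>
    (\<exists>z\<in>carrier H. \<nu> z = d))" for n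
  define R where "R n = (\<lambda>(H :: nat monoid, \<nu>, f) (H' :: nat monoid, \<nu>', f' :: 'g \<Rightarrow> nat).
    embeds id H \<nu> H' \<nu>' \<and> separates id H \<nu> H' \<and> (\<forall>x\<in>B n. f' x = (f x :: nat)))" for n
  have "\<exists>F. \<forall>n. P n (F n) \<and> R n (F n) (F (Suc n))"
  proof (rule dependent_nat_choice)
    obtain H :: "nat monoid" and \<nu> where H: "finite (carrier H)" "valued H \<nu>" "\<exists>z\<in>carrier H. \<nu> z = d"
      by (rule finite_valued_group_with_value[OF d])
    interpret H: group H by (rule valuedD(1)[OF H(2)])
    have "B 0 = {\<one>\<^bsub>A\<^esub>}" by (simp add: B_def A.generate_empty)
    then have "embeds (\<lambda>_. \<one>\<^bsub>H\<^esub>) (G 0) \<mu> H \<nu>"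
      using valued_one[OF H(2)] valued_one[OF A] by (auto simp: embeds_def hom_def)
    then have "P 0 (H, \<nu>, \<lambda>_. \<one>\<^bsub>H\<^esub>)" using H by (simp add: P_def)
    then show "\<exists>x. P 0 x" ..
  next
    fix x n assume Px: "P n x"
    obtain H \<nu> f where x: "x = (H, \<nu>, f)" by (cases x)
    have H: "finite (carrier H)" "valued H \<nu>" "embeds f (G n) \<mu> H \<nu>" "\<exists>z\<in>carrier H. \<nu> z = d"
      using Px by (simp_all add: P_def x)
    have finG: "finite (carrier (G (Suc n)))" using finB by simp
    obtain Q :: "('a \<Rightarrow> (nat set \<times> 'g set) \<times> bool \<Rightarrow> (nat set \<times> 'g set) \<times> bool) monoid" and \<pi> f1 f2
      where Q: "finite (carrier Q)" "valued Q \<pi>" "embeds f1 H \<nu> Q \<pi>" "embeds f2 (G (Suc n)) \<mu> Q \<pi>"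
        "\<And>x. x \<in> carrier (G n) \<Longrightarrow> f1 (f x) = f2 (id x)" "separates f1 H \<nu> Q"
      by (rule valued_amalgam[OF G[of n] H(2) G[of "Suc n"] H(3) GSuc[of n] H(1) finG]) (rule that; assumption)
    have "\<exists>i. inj_on i (carrier Q) \<and> range i \<subseteq> (UNIV :: nat set)"
      using finite_imp_inj_to_nat_seg[OF Q(1)] by blast
    then obtain i where i: "inj_on i (carrier Q)" "range i \<subseteq> (UNIV :: nat set)" by blast
    have "\<exists>N. \<forall>m\<in>carrier H. m < N"
      using H(1) unfolding finite_nat_set_iff_bounded .
    then obtain N where N: "\<forall>m\<in>carrier H. m < N" by (rule exE)
    \<comment> \<open>All names of elements of the finite group \<open>H\<close> are below \<open>N\<close>.\<close>
    define j where "j p = N + i p" for p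
    have jinj: "inj_on j (carrier Q)"
      unfolding j_def by (rule inj_onI) (rule inj_onD[OF i(1)], simp_all)
    have "j p \<notin> carrier H" for p
    proof
      assume "j p \<in> carrier H"
      then have "j p < N" using N by (rule bspec[rotated])
      then show False by (simp add: j_def)
    qed
    then have jdisj: "j ` carrier Q \<inter> carrier H = {}" by blast
    obtain H' :: "nat monoid" and \<nu>' h where H': "valued H' \<nu>'" "embeds h Q \<pi> H' \<nu>'" "h ` carrier Q = carrier H'"
      "carrier H' \<subseteq> carrier H \<union> j ` carrier Q" "\<And>x. x \<in> carrier H \<Longrightarrow> h (f1 x) = x" "embeds id H \<nu> H' \<nu>'"
      by (rule rename_extension[OF H(2) Q(2,3) jinj jdisj]) (rule that; assumption)
    have "P (Suc n) (H', \<nu>', h \<circ> f2)"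
      unfolding P_def prod.case
    proof (intro conjI)
      show "finite (carrier H')" unfolding H'(3)[symmetric] using Q(1) by simp
      show "embeds (h \<circ> f2) (G (Suc n)) \<mu> H' \<nu>'" by (rule embeds_trans[OF Q(4) H'(2)])
      show "\<exists>z\<in>carrier H'. \<nu>' z = d"
      proof -
        obtain z where z: "z \<in> carrier H" "\<nu> z = d" using H(4) by (elim bexE)
        then show ?thesis
          using subsetD[OF embeds_id_subset[OF H'(6)] z(1)] embedsD(3)[OF H'(6) z(1)]
          by (intro bexI[of _ z]) simp_all
      qed
    qed (rule H')
    moreover have "R n x (H', \<nu>', h \<circ> f2)"
      unfolding R_def x prod.case
    proof (intro conjI ballI)
      have "separates (h \<circ> f1) H \<nu> H'"
        using embedsD(2)[OF Q(3)] valuedD(1)[OF Q(2)] valuedD(1)[OF H'(1)] embedsD(1)[OF H'(2)]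
        by (intro separates_comp[OF _ Q(6)]) auto
      then show "separates id H \<nu> H'"
        by (rule separates_cong) (simp add: H'(5))
      show "(h \<circ> f2) y = f y" if "y \<in> B n" for y
        using Q(5)[of y] that H'(5)[of "f y"] embedsD(2)[OF H(3)] by simp
    qed (rule H')
    ultimately show "\<exists>y. P (Suc n) y \<and> R n x y" by (intro exI conjI)
  qed
  then obtain F where F: "\<And>n. P n (F n)" "\<And>n. R n (F n) (F (Suc n))" by blast
  define S where "S n = fst (F n)" for n
  define \<sigma> where "\<sigma> n = fst (snd (F n))" for n
  define f where "f n = snd (snd (F n))" for n
  have F_eq: "F n = (S n, \<sigma> n, f n)" for n by (simp add: S_def \<sigma>_def f_def)
  have S: "finite (carrier (S n))" "valued (S n) (\<sigma> n)" "embeds (f n) (G n) \<mu> (S n) (\<sigma> n)"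
    "\<exists>z\<in>carrier (S n). \<sigma> n z = d" for n
    using F(1)[of n] unfolding F_eq P_def by simp_all
  have step: "embeds id (S n) (\<sigma> n) (S (Suc n)) (\<sigma> (Suc n))" "separates id (S n) (\<sigma> n) (S (Suc n))"
    "\<And>x. x \<in> B n \<Longrightarrow> f (Suc n) x = f n x" for n
    using F(2)[of n] unfolding F_eq R_def by simp_all
  have le: "embeds id (S n) (\<sigma> n) (S m) (\<sigma> m)" if "n \<le> m" for n m
    using that
  proof (induction m rule: dec_induct)
    case base
    show ?case by (rule embeds_refl)
  next
    case (step m)
    show ?case by (rule embeds_id_trans[OF step.IH]) fact
  qed
  have chain: "embeds id (S n) (\<sigma> n) (S m) (\<sigma> m) \<or> embeds id (S m) (\<sigma> m) (S n) (\<sigma> n)" for n m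
    using le[of n m] le[of m n] by linarith
  have f_le: "f m x = f n x" if "n \<le> m" "x \<in> B n" for n m x
    using that(1)
  proof (induction m rule: dec_induct)
    case (step m)
    then show ?case using \<open>\<And>n x. x \<in> B n \<Longrightarrow> f (Suc n) x = f n x\<close>[of x m] mono[of n m] that(2) by auto
  qed simp
  obtain U :: "nat monoid" and \<upsilon> where U: "valued U \<upsilon>" "carrier U = (\<Union>n\<in>UNIV. carrier (S n))"
    "\<And>n. n \<in> UNIV \<Longrightarrow> embeds id (S n) (\<sigma> n) U \<upsilon>"
    by (rule valued_chain_union[of "UNIV :: nat set" S \<sigma>, OF UNIV_not_empty S(2) chain]) (rule that; assumption)
  have sub: "carrier (S n) \<subseteq> carrier (S m) \<or> carrier (S m) \<subseteq> carrier (S n)" for n m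
    using chain[of n m] embeds_id_subset by blast
  \<comment> \<open>The maps \<open>f n\<close> extend each other, so they have a common extension to \<open>A\<close>.\<close>
  define g where "g x = f (LEAST n. x \<in> B n) x" for x
  have g: "g x = f n x" if "x \<in> B n" for n x
    unfolding g_def
    by (rule f_le[symmetric, OF Least_le[of "\<lambda>n. x \<in> B n", OF that] LeastI[of "\<lambda>n. x \<in> B n", OF that]])
  show thesis
  proof (rule that[OF U(1)])
    show "locally_finite_group U"
    proof (rule locally_finite_union[OF U(1,2) _ U(3) _ sub])
      fix n
      interpret group "S n" by (rule valuedD(1)[OF S(2)])
      show "locally_finite_group (S n)"
      proof unfold_locales
        fix Y assume "Y \<subseteq> carrier (S n)"
        then show "finite (generate (S n) Y)"
          by (rule finite_subset[OF generate_incl S(1)])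
      qed
    qed auto
    show "separates id U \<upsilon> U"
    proof (rule separates_id_union[OF U(1,2) S(2) U(3) _ sub])
      show "\<exists>m\<in>UNIV. carrier (S n) \<subseteq> carrier (S m) \<and> separates id (S n) (\<sigma> n) (S m)" for n
        using step(2)[of n] embeds_id_subset[OF step(1)[of n]] by blast
    qed auto
    show "\<exists>z\<in>carrier U. \<upsilon> z = d"
    proof -
      obtain z where z: "z \<in> carrier (S 0)" "\<sigma> 0 z = d" using S(4)[of 0] by (elim bexE)
      then show ?thesis
        using subsetD[OF embeds_id_subset[OF U(3)[of 0]] z(1)] embedsD(3)[OF U(3)[of 0] z(1)]
        by (intro bexI[of _ z]) simp_all
    qed
    show "embeds g A \<mu> U \<upsilon>"
      unfolding embeds_def
    proof (intro conjI homI ballI)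
      fix x assume "x \<in> carrier A"
      then obtain n where n: "x \<in> B n" using UB by blast
      have fx: "f n x \<in> carrier (S n)" using embedsD(2)[OF S(3)[of n]] n by simp
      then show "g x \<in> carrier U" using U(2) by (auto simp: g[OF n])
      show "\<upsilon> (g x) = \<mu> x"
        using embedsD(3)[OF U(3)[of n] fx] embedsD(3)[OF S(3)[of n]] n by (simp add: g[OF n])
    next
      fix x y assume "x \<in> carrier A" "y \<in> carrier A"
      then obtain n m where "x \<in> B n" "y \<in> B m" using UB by blast
      then have xy: "x \<in> B (max n m)" "y \<in> B (max n m)" using mono[of n "max n m"] mono[of m "max n m"] by auto
      let ?k = "max n m"
      have "x \<otimes>\<^bsub>A\<^esub> y \<in> B ?k" using subgroup.m_closed[OF B xy] .
      moreover have "f ?k (x \<otimes>\<^bsub>A\<^esub> y) = f ?k x \<otimes>\<^bsub>S ?k\<^esub> f ?k y"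
        using embedsD(4)[OF S(3)[of ?k], of x y] xy by (simp add: G_def)
      moreover have "f ?k x \<otimes>\<^bsub>S ?k\<^esub> f ?k y = f ?k x \<otimes>\<^bsub>U\<^esub> f ?k y"
        using embedsD(4)[OF U(3)[of ?k], of "f ?k x" "f ?k y"] embedsD(2)[OF S(3)[of ?k]] xy by simp
      ultimately show "g (x \<otimes>\<^bsub>A\<^esub> y) = g x \<otimes>\<^bsub>U\<^esub> g y"
        using g xy by simp
    qed
  qed
qed

end

section \<open>A chain of countable groups indexed by the compact elements\<close>

lemma countable_of_le_natLeq: "|A| \<le>o natLeq \<Longrightarrow> countable A"
proof -
  assume "|A| \<le>o natLeq"
  then have "|A| \<le>o |UNIV :: nat set|"
    using ordLeq_ordIso_trans ordIso_symmetric[OF card_of_nat] by blast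
  then show ?thesis
    unfolding card_of_ordLeq[symmetric] countable_def by blast
qed

text \<open>In a cardinal order, every proper initial segment has smaller cardinality than the whole set.\<close>

lemma countable_initial_segments:
  fixes C :: "'a set"
  assumes "|C| \<le>o cardSuc natLeq"
  obtains R :: "'a rel" where "wf R" "trans R"
    "\<And>a b. \<lbrakk>a \<in> C; b \<in> C\<rbrakk> \<Longrightarrow> a = b \<or> (a, b) \<in> R \<or> (b, a) \<in> R"
    "\<And>a. a \<in> C \<Longrightarrow> countable {b. (b, a) \<in> R}" "R \<subseteq> C \<times> C"
proof -
  let ?r = "|C|"
  have wo: "well_order_on C ?r" by (rule card_of_well_order_on)
  have F: "Field ?r = C" by (rule Field_card_of)
  show thesis
  proof (rule that[of "?r - Id"])
    show "wf (?r - Id)" using wo by (simp add: well_order_on_def)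
    have "trans ?r" "antisym ?r" "total_on C ?r"
      using wo by (simp_all add: order_on_defs)
    then show "trans (?r - Id)" "\<And>a b. \<lbrakk>a \<in> C; b \<in> C\<rbrakk> \<Longrightarrow> a = b \<or> (a, b) \<in> ?r - Id \<or> (b, a) \<in> ?r - Id"
      by (auto simp: trans_diff_Id total_on_def)
    show "?r - Id \<subseteq> C \<times> C" using F by (auto simp: Field_def)
    fix a assume a: "a \<in> C"
    have "|underS ?r a| <o ?r" using a F by (intro card_of_underS card_of_Card_order) auto
    then have "|underS ?r a| <o cardSuc natLeq" using assms by (rule ordLess_ordLeq_trans)
    then have "|underS ?r a| \<le>o natLeq"
      using cardSuc_ordLeq_ordLess[OF natLeq_Card_order card_of_Card_order] by blast
    then have "countable (underS ?r a)" by (rule countable_of_le_natLeq)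
    moreover have "{b. (b, a) \<in> ?r - Id} = underS ?r a" by (auto simp: underS_def)
    ultimately show "countable {b. (b, a) \<in> ?r - Id}" by simp
  qed
qed

text \<open>
  Since \<open>\<aleph>\<^sub>1\<close> is at most the continuum, \<open>C\<close> embeds into the sets of natural numbers. A pair of such a set
  \<open>A\<close> and a number \<open>n\<close> is coded by putting \<open>n\<close> on the even numbers and \<open>A\<close> on the odd ones.
\<close>

lemma inj_into_nat_set:
  fixes C :: "'a set"
  assumes "|C| \<le>o cardSuc natLeq"
  obtains h :: "('a \<times> nat) option \<Rightarrow> nat set" where "inj_on h (insert None (Some ` (C \<times> UNIV)))"
proof -
  have "natLeq <o |UNIV :: nat set set|"
    using ordIso_ordLess_trans[OF ordIso_symmetric[OF card_of_nat] card_of_Pow] by simp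
  then have "cardSuc natLeq \<le>o |UNIV :: nat set set|"
    using cardSuc_least[OF natLeq_Card_order card_of_Card_order] by blast
  then have "|C| \<le>o |UNIV :: nat set set|" using assms ordLeq_transitive by blast
  then obtain g :: "'a \<Rightarrow> nat set" where g: "inj_on g C"
    unfolding card_of_ordLeq[symmetric] by blast
  define h where "h = case_option {} (\<lambda>(c, n). insert (2 * n) ((\<lambda>k. 2 * k + 1) ` g c))"
  have "inj_on h (insert None (Some ` (C \<times> UNIV)))"
  proof (rule inj_onI)
    fix x y assume xy: "x \<in> insert None (Some ` (C \<times> UNIV))" "y \<in> insert None (Some ` (C \<times> UNIV))" "h x = h y"
    have parity: "Suc (2 * k) \<noteq> 2 * n" "2 * n \<noteq> Suc (2 * k)" for k n :: nat by presburger+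
    have odd: "{k. 2 * k + 1 \<in> insert (2 * n) ((\<lambda>k. 2 * k + 1) ` A)} = A" for n and A :: "nat set"
      using parity by (auto simp: image_iff)
    have even: "{k. 2 * k \<in> insert (2 * n) ((\<lambda>k. 2 * k + 1) ` A)} = {n}" for n and A :: "nat set"
      using parity by (force simp: image_iff)
    show "x = y"
    proof (cases "x = None \<or> y = None")
      case True
      then show ?thesis using xy by (auto simp: h_def)
    next
      case False
      then obtain c n d m where c: "x = Some (c, n)" "c \<in> C" "y = Some (d, m)" "d \<in> C"
        using xy by auto
      then have eq: "insert (2 * n) ((\<lambda>k. 2 * k + 1) ` g c) = insert (2 * m) ((\<lambda>k. 2 * k + 1) ` g d)"
        using xy(3) by (simp add: h_def)
      have "g c = g d" using odd[of n "g c"] odd[of m "g d"] unfolding eq by simp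
      moreover have "n = m" using even[of n "g c"] even[of m "g d"] unfolding eq by simp
      ultimately show ?thesis using c g by (auto dest: inj_onD)
    qed
  qed
  then show thesis by (rule that)
qed

context distributive_algebraic_lattice
begin

lemma trivial_valued_group:
  fixes e :: 'g
  defines "T \<equiv> \<lparr>carrier = {e}, monoid.mult = \<lambda>_ _. e, one = e\<rparr>"
  shows "valued T (\<lambda>_. \<Squnion>{})" "locally_finite_group T"
proof -
  have T: "group T" by (rule groupI) (auto simp: T_def)
  then interpret group T .
  have [simp]: "carrier T = {e}" "\<one>\<^bsub>T\<^esub> = e" by (simp_all add: T_def)
  have eq: "{x \<in> carrier T. \<Squnion>{} \<sqsubseteq> d} = {\<one>\<^bsub>T\<^esub>}" if "d \<in> carrier L" for d
    using sup_empty_le[OF that] by auto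
  show "valued T (\<lambda>_. \<Squnion>{})"
    unfolding valued_def
  proof (intro conjI ballI impI)
    show "{x \<in> carrier T. \<Squnion>{} \<sqsubseteq> d} \<lhd> T" if "d \<in> carrier L" for d
      unfolding eq[OF that] by (rule one_is_normal)
  qed (use T compact_Sup[of "{}"] in auto)
  show "locally_finite_group T"
  proof unfold_locales
    fix A assume "A \<subseteq> carrier T"
    then show "finite (generate T A)" using generate_incl[of A] finite_subset by auto
  qed
qed

text \<open>
  By recursion along the well-order \<open>R\<close>, stage \<open>a\<close> extends the union of all earlier stages by
  \<open>countable_extension\<close>. New elements of stage \<open>a\<close> are named \<open>Some (a, n)\<close>, which makes them different from
  all earlier elements and bounds the cardinality of the carrier.
\<close>

lemma realizing_valued_group:
  assumes card: "|compact_elements L| \<le>o cardSuc natLeq"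
  obtains U :: "('a \<times> nat) option monoid" and \<upsilon>
  where "valued U \<upsilon>" "locally_finite_group U" "separates id U \<upsilon> U"
    "\<And>d. d \<in> compact_elements L \<Longrightarrow> \<exists>z\<in>carrier U. \<upsilon> z = d"
    "carrier U \<subseteq> insert None (Some ` (compact_elements L \<times> UNIV))"
proof -
  let ?C = "compact_elements L"
  obtain R where R: "wf R" "trans R"
    and tot: "\<And>a b. \<lbrakk>a \<in> ?C; b \<in> ?C\<rbrakk> \<Longrightarrow> a = b \<or> (a, b) \<in> R \<or> (b, a) \<in> R"
    and cnt: "\<And>a. a \<in> ?C \<Longrightarrow> countable {b. (b, a) \<in> R}" and RC: "R \<subseteq> ?C \<times> ?C"
    by (rule countable_initial_segments[OF card]) (rule that; assumption)
  define good where "good a = (\<lambda>(G :: ('a \<times> nat) option monoid, \<mu>). valued G \<mu> \<and> locally_finite_group G \<and>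
      separates id G \<mu> G \<and> (\<exists>z\<in>carrier G. \<mu> z = a) \<and>
      carrier G \<subseteq> insert None (Some ` (insert a {b. (b, a) \<in> R} \<times> UNIV)))" for a
  define sub where "sub = (\<lambda>(G :: ('a \<times> nat) option monoid, \<mu>) (H :: ('a \<times> nat) option monoid, \<nu>).
    embeds id G \<mu> H \<nu>)"
  have "\<exists>F. \<forall>a. a \<in> ?C \<longrightarrow> good a (F a) \<and> (\<forall>b. (b, a) \<in> R \<longrightarrow> sub (F b) (F a))"
  proof (rule dependent_wf_choice[OF R(1)])
    fix f g :: "'a \<Rightarrow> ('a \<times> nat) option monoid \<times> (('a \<times> nat) option \<Rightarrow> 'a)" and a s
    assume "\<And>b. (b, a) \<in> R \<Longrightarrow> f b = g b"
    then have "(\<forall>b. (b, a) \<in> R \<longrightarrow> sub (f b) s) \<longleftrightarrow> (\<forall>b. (b, a) \<in> R \<longrightarrow> sub (g b) s)" by metis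
    then show "(a \<in> ?C \<longrightarrow> good a s \<and> (\<forall>b. (b, a) \<in> R \<longrightarrow> sub (f b) s)) =
      (a \<in> ?C \<longrightarrow> good a s \<and> (\<forall>b. (b, a) \<in> R \<longrightarrow> sub (g b) s))" by argo
  next
    fix a and f :: "'a \<Rightarrow> ('a \<times> nat) option monoid \<times> (('a \<times> nat) option \<Rightarrow> 'a)"
    assume IH: "\<And>b. (b, a) \<in> R \<Longrightarrow> b \<in> ?C \<longrightarrow> good b (f b) \<and> (\<forall>c. (c, b) \<in> R \<longrightarrow> sub (f c) (f b))"
    show "\<exists>s. a \<in> ?C \<longrightarrow> good a s \<and> (\<forall>b. (b, a) \<in> R \<longrightarrow> sub (f b) s)"
    proof (cases "a \<in> ?C")
      case aC: True
      define I where "I = {b. (b, a) \<in> R}"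
      define S where "S b = fst (f b)" for b
      define \<sigma> where "\<sigma> b = snd (f b)" for b
      have f_eq: "f b = (S b, \<sigma> b)" for b by (simp add: S_def \<sigma>_def)
      have IC: "I \<subseteq> ?C" using RC by (auto simp: I_def)
      have good: "valued (S b) (\<sigma> b)" "locally_finite_group (S b)"
        "carrier (S b) \<subseteq> insert None (Some ` (insert b {c. (c, b) \<in> R} \<times> UNIV))" if "b \<in> I" for b
        using IH[of b] that IC unfolding f_eq good_def I_def by auto
      have subI: "embeds id (S c) (\<sigma> c) (S b) (\<sigma> b)" if "b \<in> I" "(c, b) \<in> R" for b c
        using IH[of b] that IC unfolding f_eq sub_def I_def by auto
      have chain: "embeds id (S b) (\<sigma> b) (S c) (\<sigma> c) \<or> embeds id (S c) (\<sigma> c) (S b) (\<sigma> b)"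
        if "b \<in> I" "c \<in> I" for b c
        using tot[of b c] that IC subI embeds_refl by blast
      have "\<exists>(A :: ('a \<times> nat) option monoid) \<mu>. valued A \<mu> \<and> locally_finite_group A \<and> carrier A \<subseteq> insert None (Some ` (I \<times> UNIV)) \<and>
        (\<forall>b\<in>I. embeds id (S b) (\<sigma> b) A \<mu>)"
      proof (cases "I = {}")
        case True
        define T :: "('a \<times> nat) option monoid"
          where "T = \<lparr>carrier = {None}, monoid.mult = \<lambda>_ _. None, one = None\<rparr>"
        have "valued T (\<lambda>_. \<Squnion>{})" "locally_finite_group T"
          unfolding T_def by (rule trivial_valued_group)+
        moreover have "carrier T \<subseteq> insert None (Some ` (I \<times> UNIV))" by (simp add: T_def)
        moreover have "\<forall>b\<in>I. embeds id (S b) (\<sigma> b) T (\<lambda>_. \<Squnion>{})" using True by simp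
        ultimately show ?thesis by (intro exI conjI)
      next
        case False
        obtain A :: "('a \<times> nat) option monoid" and \<mu> where A: "valued A \<mu>" "carrier A = (\<Union>b\<in>I. carrier (S b))"
          "\<And>b. b \<in> I \<Longrightarrow> embeds id (S b) (\<sigma> b) A \<mu>"
          by (rule valued_chain_union[where S = S and \<mu> = \<sigma>, OF False good(1) chain]; (assumption | (rule that; assumption)))
        have "locally_finite_group A"
        proof (rule locally_finite_union[OF A(1,2) good(2) A(3) False])
          show "carrier (S b) \<subseteq> carrier (S c) \<or> carrier (S c) \<subseteq> carrier (S b)" if "b \<in> I" "c \<in> I" for b c
            using chain[OF that] embeds_id_subset by blast
        qed
        moreover have "carrier A \<subseteq> insert None (Some ` (I \<times> UNIV))"
          unfolding A(2)
        proof (rule UN_least)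
          fix b assume b: "b \<in> I"
          then have "insert b {c. (c, b) \<in> R} \<subseteq> I" using R(2) by (auto simp: I_def dest: transD)
          then show "carrier (S b) \<subseteq> insert None (Some ` (I \<times> UNIV))" using good(3)[OF b] by blast
        qed
        ultimately show ?thesis using A by (intro exI conjI ballI)
      qed
      then obtain A :: "('a \<times> nat) option monoid" and \<mu> where A: "valued A \<mu>" "locally_finite_group A"
        "carrier A \<subseteq> insert None (Some ` (I \<times> UNIV))" "\<forall>b\<in>I. embeds id (S b) (\<sigma> b) A \<mu>"
        by (elim exE conjE)
      have "countable (insert None (Some ` (I \<times> (UNIV :: nat set))))"
        using cnt[OF aC] by (simp add: I_def)
      then have cA: "countable (carrier A)" using A(3) countable_subset by blast
      obtain H :: "nat monoid" and \<nu> f' where H: "valued H \<nu>" "locally_finite_group H" "embeds f' A \<mu> H \<nu>"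
        "separates id H \<nu> H" "\<exists>z\<in>carrier H. \<nu> z = a"
        by (rule countable_extension[OF A(1,2) cA aC]) (rule that; assumption)
      \<comment> \<open>Names built from \<open>a\<close> are fresh, because earlier stages only use names built from members of \<open>I\<close>.\<close>
      have "(a, a) \<notin> R" using R(1) by (meson wf_not_refl)
      then have disj: "(\<lambda>n. Some (a, n)) ` carrier H \<inter> carrier A = {}"
        using A(3) by (auto simp: I_def)
      have inj: "inj_on (\<lambda>n. Some (a, n)) (carrier H)" by (auto simp: inj_on_def)
      obtain K :: "('a \<times> nat) option monoid" and \<kappa> h where K: "valued K \<kappa>" "embeds h H \<nu> K \<kappa>"
        "h ` carrier H = carrier K" "carrier K \<subseteq> carrier A \<union> (\<lambda>n. Some (a, n)) ` carrier H"
        "\<And>x. x \<in> carrier A \<Longrightarrow> h (f' x) = x" "embeds id A \<mu> K \<kappa>"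
        by (rule rename_extension[OF A(1) H(1,3) inj disj]) (rule that; assumption)
      have "good a (K, \<kappa>)"
        unfolding good_def prod.case
      proof (intro conjI)
        show "locally_finite_group K"
          by (rule locally_finite_surj_image[OF H(2) valuedD(1)[OF K(1)] embedsD(1)[OF K(2)] K(3)])
        show "separates id K \<kappa> K"
          by (rule separates_surj[OF valuedD(1)[OF H(1)] valuedD(1)[OF K(1)] H(4) K(2,3)])
        obtain z where "z \<in> carrier H" "\<nu> z = a" using H(5) by (elim bexE)
        then show "\<exists>z\<in>carrier K. \<kappa> z = a"
          using embedsD(2,3)[OF K(2), of z] by (intro bexI[of _ "h z"]) simp_all
        show "carrier K \<subseteq> insert None (Some ` (insert a {b. (b, a) \<in> R} \<times> UNIV))"
          using K(4) A(3) unfolding I_def by blast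
      qed (rule K)
      moreover have "sub (f b) (K, \<kappa>)" if "(b, a) \<in> R" for b
        unfolding sub_def f_eq prod.case
        by (rule embeds_id_trans[OF A(4)[rule_format] K(6)]) (use that in \<open>simp add: I_def\<close>)
      ultimately show ?thesis by (intro exI impI conjI allI)
    next
      case False
      then show ?thesis by simp
    qed
  qed
  then obtain F where F: "\<And>a. a \<in> ?C \<Longrightarrow> good a (F a)"
    "\<And>a b. \<lbrakk>a \<in> ?C; (b, a) \<in> R\<rbrakk> \<Longrightarrow> sub (F b) (F a)"
    by metis
  define S where "S b = fst (F b)" for b
  define \<sigma> where "\<sigma> b = snd (F b)" for b
  have F_eq: "F b = (S b, \<sigma> b)" for b by (simp add: S_def \<sigma>_def)
  have S: "valued (S b) (\<sigma> b)" "locally_finite_group (S b)" "separates id (S b) (\<sigma> b) (S b)"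
    "\<exists>z\<in>carrier (S b). \<sigma> b z = b"
    "carrier (S b) \<subseteq> insert None (Some ` (insert b {c. (c, b) \<in> R} \<times> UNIV))" if "b \<in> ?C" for b
    using F(1)[OF that] unfolding F_eq good_def by simp_all
  have subC: "embeds id (S c) (\<sigma> c) (S b) (\<sigma> b)" if "b \<in> ?C" "(c, b) \<in> R" for b c
    using F(2)[OF that] unfolding F_eq sub_def by simp
  have chain: "embeds id (S b) (\<sigma> b) (S c) (\<sigma> c) \<or> embeds id (S c) (\<sigma> c) (S b) (\<sigma> b)"
    if "b \<in> ?C" "c \<in> ?C" for b c
    using tot[of b c] that subC embeds_refl by blast
  have sub: "carrier (S b) \<subseteq> carrier (S c) \<or> carrier (S c) \<subseteq> carrier (S b)" if "b \<in> ?C" "c \<in> ?C" for b c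
    using chain[OF that] embeds_id_subset by blast
  have ne: "?C \<noteq> {}" using compact_Sup[of "{}"] by blast
  obtain U :: "('a \<times> nat) option monoid" and \<upsilon> where U: "valued U \<upsilon>" "carrier U = (\<Union>b\<in>?C. carrier (S b))"
    "\<And>b. b \<in> ?C \<Longrightarrow> embeds id (S b) (\<sigma> b) U \<upsilon>"
    by (rule valued_chain_union[where S = S and \<mu> = \<sigma>, OF ne S(1) chain]; (assumption | (rule that; assumption)))
  show thesis
  proof (rule that[OF U(1)])
    show "locally_finite_group U"
      by (rule locally_finite_union[OF U(1,2) S(2) U(3) ne sub])
    show "separates id U \<upsilon> U"
      by (rule separates_id_union[OF U(1,2) S(1) U(3) ne sub]) (use S(3) in blast)+
    show "\<exists>z\<in>carrier U. \<upsilon> z = d" if d: "d \<in> ?C" for d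
    proof -
      obtain z where "z \<in> carrier (S d)" "\<sigma> d z = d" using S(4)[OF d] by (elim bexE)
      then show ?thesis
        using embedsD(2,3)[OF U(3)[OF d], of z] by (intro bexI[of _ z]) simp_all
    qed
    show "carrier U \<subseteq> insert None (Some ` (?C \<times> UNIV))"
      unfolding U(2)
    proof (rule UN_least)
      fix b assume "b \<in> ?C"
      then show "carrier (S b) \<subseteq> insert None (Some ` (?C \<times> UNIV))" using S(5) RC by blast
    qed
  qed
qed

end

section \<open>Normal subgroups of self-separating groups\<close>

context distributive_algebraic_lattice
begin

text \<open>
  Surjectivity is where the separation property enters: if \<open>N\<close> is normal and \<open>\<mu> x \<sqsubseteq> \<Squnion>(\<mu> ` N)\<close>, then by
  compactness \<open>\<mu> x \<sqsubseteq> \<Squnion>(\<mu> ` Y)\<close> for a finite \<open>Y \<subseteq> N\<close>, whence \<open>x \<in> N\<close>.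
\<close>

lemma lattice_isomorphic_normal_subgroups:
  assumes v: "valued G \<mu>" and s: "separates id G \<mu> G"
    and surj: "\<And>d. d \<in> compact_elements L \<Longrightarrow> \<exists>z\<in>carrier G. \<mu> z = d"
  shows "lattice_isomorphic L (normal_subgroup_lattice G)"
proof -
  define \<phi> where "\<phi> d = {x \<in> carrier G. \<mu> x \<sqsubseteq> d}" for d
  interpret group G by (rule valuedD(1)[OF v])
  have mono: "d \<sqsubseteq> e \<longleftrightarrow> \<phi> d \<subseteq> \<phi> e" if d: "d \<in> carrier L" and e: "e \<in> carrier L" for d e
  proof
    assume de: "d \<sqsubseteq> e"
    show "\<phi> d \<subseteq> \<phi> e"
    proof
      fix x assume x: "x \<in> \<phi> d"
      then have "\<mu> x \<sqsubseteq> e"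
        by (intro le_trans[OF _ de _ d e]) (use valuedD(3)[OF v] in \<open>simp_all add: \<phi>_def\<close>)
      then show "x \<in> \<phi> e" using x by (simp add: \<phi>_def)
    qed
  next
    assume sub: "\<phi> d \<subseteq> \<phi> e"
    obtain K where K: "K \<subseteq> compact_elements L" "d = \<Squnion>K" using sup_of_compacts[OF d] by blast
    have KL: "K \<subseteq> carrier L" using K(1) compact_carrier by blast
    have "k \<sqsubseteq> e" if k: "k \<in> K" for k
    proof -
      obtain z where z: "z \<in> carrier G" "\<mu> z = k" using surj[of k] k K(1) by blast
      have "k \<sqsubseteq> d" unfolding K(2) using sup_upper[OF KL k] .
      then have "z \<in> \<phi> d" using z by (simp add: \<phi>_def)
      then have "z \<in> \<phi> e" using sub by (rule rev_subsetD)
      then show ?thesis using z by (simp add: \<phi>_def)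
    qed
    then show "d \<sqsubseteq> e" unfolding K(2) by (rule sup_least[OF KL e])
  qed
  have "bij_betw \<phi> (carrier L) {N. N \<lhd> G}"
    unfolding bij_betw_def
  proof
    show "inj_on \<phi> (carrier L)"
    proof (rule inj_onI)
      fix d e assume "d \<in> carrier L" "e \<in> carrier L" "\<phi> d = \<phi> e"
      then show "d = e" using mono[of d e] mono[of e d] le_antisym[of d e] by simp
    qed
    show "\<phi> ` carrier L = {N. N \<lhd> G}"
    proof
      show "\<phi> ` carrier L \<subseteq> {N. N \<lhd> G}" unfolding \<phi>_def using valuedD(4)[OF v] by auto
      show "{N. N \<lhd> G} \<subseteq> \<phi> ` carrier L"
      proof
        fix N assume "N \<in> {N. N \<lhd> G}"
        then have N: "N \<lhd> G" by simp
        have NG: "N \<subseteq> carrier G" using normal_imp_subgroup[OF N] by (rule subgroup.subset)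
        have \<mu>N: "\<mu> ` N \<subseteq> carrier L" using NG valuedD(3)[OF v] by blast
        let ?d = "\<Squnion>(\<mu> ` N)"
        have dL: "?d \<in> carrier L" by (rule sup_closed[OF \<mu>N])
        have "\<phi> ?d = N"
        proof
          show "N \<subseteq> \<phi> ?d"
          proof
            fix x assume x: "x \<in> N"
            then have "\<mu> x \<sqsubseteq> ?d" by (intro sup_upper[OF \<mu>N] imageI)
            then show "x \<in> \<phi> ?d" using x NG by (auto simp: \<phi>_def)
          qed
          show "\<phi> ?d \<subseteq> N"
          proof
            fix x assume "x \<in> \<phi> ?d"
            then have x: "x \<in> carrier G" "\<mu> x \<sqsubseteq> ?d" by (simp_all add: \<phi>_def)
            obtain B where B: "finite B" "B \<subseteq> \<mu> ` N" "\<mu> x \<sqsubseteq> \<Squnion>B"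
              using compactD[OF valuedD(2)[OF v x(1)] \<mu>N x(2)] by (elim exE conjE)
            obtain Y where Y: "Y \<subseteq> N" "finite Y" "B = \<mu> ` Y"
              using finite_subset_image[OF B(1,2)] by (elim exE conjE)
            have "id x \<in> N"
              using s[unfolded separates_def, rule_format, OF N Y(2) _ x(1)] Y B(3) NG by simp
            then show "x \<in> N" by simp
          qed
        qed
        then show "N \<in> \<phi> ` carrier L" using dL by (intro image_eqI[of _ _ ?d]) simp_all
      qed
    qed
  qed
  then show ?thesis
    unfolding lattice_isomorphic_def normal_subgroup_lattice_def using mono
    by (intro exI[of _ \<phi>]) simp
qed

end

theorem corollary5p4:
  fixes L :: "('a, 'm) gorder_scheme"
  assumes "algebraic_lattice L"
    and "distributive_lattice L"
    and "|compact_elements L| \<le>o aleph_one"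
  shows "\<exists>G :: group_universe monoid.
           locally_finite_group G \<and> lattice_isomorphic L (normal_subgroup_lattice G)"
proof -
  interpret distributive_algebraic_lattice L
    using assms(1,2) by (simp add: distributive_algebraic_lattice_def)
  obtain U :: "('a \<times> nat) option monoid" and \<upsilon> where U: "valued U \<upsilon>" "locally_finite_group U"
    "separates id U \<upsilon> U" "\<And>d. d \<in> compact_elements L \<Longrightarrow> \<exists>z\<in>carrier U. \<upsilon> z = d"
    "carrier U \<subseteq> insert None (Some ` (compact_elements L \<times> UNIV))"
    by (rule realizing_valued_group[OF assms(3)]) (rule that; assumption)
  obtain h :: "('a \<times> nat) option \<Rightarrow> nat set"
    where "inj_on h (insert None (Some ` (compact_elements L \<times> UNIV)))"
    by (rule inj_into_nat_set[OF assms(3)])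
  then have h: "inj_on h (carrier U)" using U(5) by (rule inj_on_subset)
  obtain G :: "group_universe monoid" and \<mu> where G: "valued G \<mu>" "carrier G = h ` carrier U"
    "embeds h U \<upsilon> G \<mu>"
    by (rule valued_image[OF U(1) h]) (rule that; assumption)
  have "lattice_isomorphic L (normal_subgroup_lattice G)"
  proof (rule lattice_isomorphic_normal_subgroups[OF G(1)])
    show "separates id G \<mu> G"
      by (rule separates_surj[OF valuedD(1)[OF U(1)] valuedD(1)[OF G(1)] U(3) G(3) G(2)[symmetric]])
    show "\<exists>z\<in>carrier G. \<mu> z = d" if d: "d \<in> compact_elements L" for d
    proof -
      obtain z where "z \<in> carrier U" "\<upsilon> z = d" using U(4)[OF d] by (elim bexE)
      then show ?thesis
        using embedsD(2,3)[OF G(3), of z] by (intro bexI[of _ "h z"]) simp_all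
    qed
  qed
  moreover have "locally_finite_group G"
    by (rule locally_finite_surj_image[OF U(2) valuedD(1)[OF G(1)] embedsD(1)[OF G(3)] G(2)[symmetric]])
  ultimately show ?thesis by blast
qed

end
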